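(* The set of bounded singular integral operators $\mathcal{S}:=\{S_\varphi\in\mathcal{L}(F^2):\varphi\in F^2\}$ coincides with the von Neumann algebra of vertical operators $$\mathcal{A}_{\mathbb{R}}:=\{A\in\mathcal{L}(F^2): \alpha_h(A)=A\ \text{ for all } h\in\mathbb{R}\}.$$
   Context: $\mu$ is the Gaussian measure $d\mu(z)=\frac1\pi e^{-|z|^2}dz$ on $\mathbb{C}$, and $F^2=L^2(\mathbb{C},\mu)\cap\operatorname{Hol}(\mathbb{C})$ is the Fock space. For $\varphi\in F^2$ the singular integral operator is $$S_\varphi f(z)=\int_{\mathbb{C}}f(w)e^{z\overline w}\varphi(z-\overline w)\,d\mu(w),$$ defined at least on the (dense) linear span of the reproducing kernels $K_u(w)=e^{w\overline u}$, $u\in\mathbb{C}$; $S_\varphi\in\mathcal{L}(F^2)$ means that $S_\varphi$ is bounded, i.e. extends to a bounded operator on $F^2$. For $z\in\mathbb{C}$ the (unitary) Weyl operator on $F^2$ is $W_zf(w)=k_z(w)f(w-z)$ with $k_z(w)=e^{w\overline z-|z|^2/2}$, and $\alpha_z(A)=W_zAW_z^*=W_zAW_{-z}$ for $A\in\mathcal{L}(F^2)$. *)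

theory Defs
  imports "HOL-Probability.Probability"
begin

definition gauss :: "complex measure" where
  "gauss = density lborel (\<lambda>z. ennreal (exp (- (norm z)\<^sup>2) / pi))"

lemma sets_gauss [simp, measurable_cong]: "sets gauss = sets borel"
  by (simp add: gauss_def)

lemma space_gauss [simp]: "space gauss = UNIV"
  by (simp add: gauss_def)

lemma prob_space_gauss: "prob_space gauss"
proof
  have norm2: "(norm z)\<^sup>2 = (\<Sum>b\<in>Basis. (z \<bullet> b)\<^sup>2)" for z :: complex
    by (simp add: Basis_complex_def cmod_power2)
  have nd: "normal_density 0 (1 / sqrt 2) x = exp (- x\<^sup>2) / sqrt pi" for x
    by (simp add: normal_density_def power_divide)
  have prod: "(\<Prod>b\<in>Basis. ennreal (normal_density 0 (1 / sqrt 2) (z \<bullet> b)))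
      = ennreal (exp (- (norm z)\<^sup>2) / pi)" for z :: complex
  proof -
    have "exp (- (norm z)\<^sup>2) / pi
        = (exp (- (Re z)\<^sup>2) / sqrt pi) * (exp (- (Im z)\<^sup>2) / sqrt pi)"
      by (simp add: cmod_power2 exp_add[symmetric] field_simps)
    then show ?thesis
      by (simp add: Basis_complex_def nd ennreal_mult'[symmetric])
  qed
  have one: "(\<integral>\<^sup>+x. ennreal (normal_density 0 (1 / sqrt 2) x) \<partial>lborel) = 1"
    by (subst nn_integral_eq_integral) auto
  have "emeasure gauss (space gauss)
      = (\<integral>\<^sup>+z. ennreal (exp (- (norm z)\<^sup>2) / pi) \<partial>(lborel :: complex measure))"
    by (simp add: gauss_def emeasure_density)
  also have "\<dots> = (\<integral>\<^sup>+z. (\<Prod>b\<in>Basis. ennreal (normal_density 0 (1 / sqrt 2) (z \<bullet> b)))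
      \<partial>(lborel :: complex measure))"
    by (simp only: prod)
  also have "\<dots> = (\<Prod>b\<in>(Basis :: complex set).
      \<integral>\<^sup>+x. ennreal (normal_density 0 (1 / sqrt 2) x) \<partial>lborel)"
    by (rule nn_integral_lborel_prod) auto
  finally show "emeasure gauss (space gauss) = 1"
    by (simp add: one)
qed

definition fock_space :: "(complex \<Rightarrow> complex) set" where
  "fock_space = {f. f holomorphic_on UNIV \<and> integrable gauss (\<lambda>z. (norm (f z))\<^sup>2)}"

lemma fock_space_measurable: "f \<in> fock_space \<Longrightarrow> f \<in> borel_measurable borel"
  by (auto simp: fock_space_def intro!: borel_measurable_continuous_onI holomorphic_on_imp_continuous_on)

lemma measurable_cnj [measurable]: "cnj \<in> borel_measurable borel"
  by (intro borel_measurable_continuous_onI continuous_intros)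

lemma fock_space_zero: "(\<lambda>_. 0) \<in> fock_space"
  by (simp add: fock_space_def)

lemma fock_space_add:
  assumes f: "f \<in> fock_space" and g: "g \<in> fock_space"
  shows "(\<lambda>z. f z + g z) \<in> fock_space"
proof -
  note [measurable] = fock_space_measurable[OF f] fock_space_measurable[OF g]
  have "integrable gauss (\<lambda>z. (norm (f z + g z))\<^sup>2)"
  proof (rule Bochner_Integration.integrable_bound)
    show "integrable gauss (\<lambda>z. 2 * (norm (f z))\<^sup>2 + 2 * (norm (g z))\<^sup>2)"
      using f g by (simp add: fock_space_def)
    have "(norm (f z + g z))\<^sup>2 \<le> 2 * (norm (f z))\<^sup>2 + 2 * (norm (g z))\<^sup>2" for z
    proof -
      have "(norm (f z + g z))\<^sup>2 \<le> (norm (f z) + norm (g z))\<^sup>2"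
        by (intro power_mono norm_triangle_ineq) auto
      also have "\<dots> \<le> 2 * (norm (f z))\<^sup>2 + 2 * (norm (g z))\<^sup>2"
        using sum_squares_bound[of "norm (f z)" "norm (g z)"] by (simp add: power2_sum)
      finally show ?thesis .
    qed
    then show "AE z in gauss. norm ((norm (f z + g z))\<^sup>2)
        \<le> norm (2 * (norm (f z))\<^sup>2 + 2 * (norm (g z))\<^sup>2)"
      by simp
  qed measurable
  then show ?thesis
    using f g by (auto simp: fock_space_def intro: holomorphic_intros)
qed

lemma fock_space_mult:
  "f \<in> fock_space \<Longrightarrow> (\<lambda>z. c * f z) \<in> fock_space"
  by (auto simp: fock_space_def norm_mult power_mult_distrib intro: holomorphic_intros)

lemma fock_space_integrable_cnj:
  assumes f: "f \<in> fock_space" and g: "g \<in> fock_space"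
  shows "integrable gauss (\<lambda>z. f z * cnj (g z))"
proof (rule Bochner_Integration.integrable_bound)
  note [measurable] = fock_space_measurable[OF f] fock_space_measurable[OF g]
  show "integrable gauss (\<lambda>z. (norm (f z))\<^sup>2 + (norm (g z))\<^sup>2)"
    using f g by (simp add: fock_space_def)
  show "(\<lambda>z. f z * cnj (g z)) \<in> borel_measurable gauss"
    by measurable
  have "norm (f z) * norm (g z) \<le> (norm (f z))\<^sup>2 + (norm (g z))\<^sup>2" for z
  proof -
    have "0 \<le> norm (f z) * norm (g z)" by simp
    then show ?thesis
      using sum_squares_bound[of "norm (f z)" "norm (g z)"] by linarith
  qed
  then show "AE z in gauss. norm (f z * cnj (g z)) \<le> norm ((norm (f z))\<^sup>2 + (norm (g z))\<^sup>2)"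
    by (simp add: norm_mult)
qed

lemma AE_gauss_iff: "(AE z in gauss. P z) \<longleftrightarrow> (AE z in lborel. P z)"
  unfolding gauss_def by (subst AE_density) auto

lemma fock_space_eq_zero:
  assumes f: "f \<in> fock_space" and 0: "(\<integral>z. (norm (f z))\<^sup>2 \<partial>gauss) = 0"
  shows "f = (\<lambda>_. 0)"
proof -
  have "AE z in gauss. (norm (f z))\<^sup>2 = 0"
    using integral_nonneg_eq_0_iff_AE[of gauss "\<lambda>z. (norm (f z))\<^sup>2"] f 0
    by (simp add: fock_space_def)
  then have "AE z in lborel. z \<in> {z. f z = 0}"
    by (simp add: AE_gauss_iff)
  then have "AE z in lebesgue. z \<in> {z. f z = 0}"
    by (rule AE_completion)
  moreover have "closed {z. f z = 0}"
    using f by (intro closed_Collect_eq)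
      (auto simp: fock_space_def intro: holomorphic_on_imp_continuous_on)
  ultimately show ?thesis
    using mem_closed_if_AE_lebesgue by blast
qed

typedef fock = fock_space
  morphisms fock_fun Abs_fock
  using fock_space_zero by blast

setup_lifting type_definition_fock

instantiation fock :: real_vector
begin

lift_definition zero_fock :: fock is "\<lambda>_. 0"
  by (rule fock_space_zero)

lift_definition plus_fock :: "fock \<Rightarrow> fock \<Rightarrow> fock" is "\<lambda>f g z. f z + g z"
  by (rule fock_space_add)

lift_definition uminus_fock :: "fock \<Rightarrow> fock" is "\<lambda>f z. - f z"
  using fock_space_mult[of _ "-1"] by simp

lift_definition minus_fock :: "fock \<Rightarrow> fock \<Rightarrow> fock" is "\<lambda>f g z. f z - g z"
  using fock_space_add[OF _ fock_space_mult[of _ "-1"]] by simp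

lift_definition scaleR_fock :: "real \<Rightarrow> fock \<Rightarrow> fock" is "\<lambda>r f z. of_real r * f z"
  by (rule fock_space_mult)

instance
  by standard (transfer; simp add: fun_eq_iff algebra_simps)+

end

lift_definition scaleC :: "complex \<Rightarrow> fock \<Rightarrow> fock" (infixr \<open>*\<^sub>C\<close> 75) is "\<lambda>c f z. c * f z"
  by (rule fock_space_mult)

interpretation cfock: vector_space scaleC
  by standard (transfer; simp add: fun_eq_iff algebra_simps)+

lift_definition cinner :: "fock \<Rightarrow> fock \<Rightarrow> complex" is "\<lambda>f g. \<integral>z. f z * cnj (g z) \<partial>gauss" .

lemma cinner_self: "cinner f f = of_real (\<integral>z. (norm (fock_fun f z))\<^sup>2 \<partial>gauss)"
  by transfer (simp add: complex_norm_square[symmetric] del: of_real_power)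

lemma cinner_add_left: "cinner (f + g) h = cinner f h + cinner g h"
  by transfer (simp add: fock_space_integrable_cnj algebra_simps)

lemma cinner_scaleC_left: "cinner (c *\<^sub>C f) g = c * cinner f g"
  by transfer (simp add: mult.assoc)

lemma cinner_commute: "cinner f g = cnj (cinner g f)"
  by transfer (simp add: mult.commute flip: Bochner_Integration.integral_cnj)

text \<open>
  The library has real inner product spaces only. The real part of the complex inner product
  induces the same norm, namely the one of \<open>L\<^sup>2(\<complex>, \<mu>)\<close>; see \<open>norm_fock\<close> below.
\<close>

instantiation fock :: real_inner
begin

definition inner_fock :: "fock \<Rightarrow> fock \<Rightarrow> real" where
  "inner_fock f g = Re (cinner f g)"

definition norm_fock :: "fock \<Rightarrow> real" where
  "norm_fock f = sqrt (inner f f)"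

definition sgn_fock :: "fock \<Rightarrow> fock" where
  "sgn_fock f = f /\<^sub>R norm f"

definition dist_fock :: "fock \<Rightarrow> fock \<Rightarrow> real" where
  "dist_fock f g = norm (f - g)"

definition uniformity_fock :: "(fock \<times> fock) filter" where
  "uniformity_fock = (INF e\<in>{0<..}. principal {(f, g). dist f g < e})"

definition open_fock :: "fock set \<Rightarrow> bool" where
  "open_fock U \<longleftrightarrow> (\<forall>x\<in>U. eventually (\<lambda>(x', y). x' = x \<longrightarrow> y \<in> U) uniformity)"

instance
proof
  fix f g h :: fock and r :: real
  show "inner f g = inner g f"
    using cinner_commute[of f g] by (simp add: inner_fock_def)
  show "inner (f + g) h = inner f h + inner g h"
    by (simp add: inner_fock_def cinner_add_left)
  have "r *\<^sub>R f = complex_of_real r *\<^sub>C f"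
    by transfer simp
  then show "inner (r *\<^sub>R f) g = r * inner f g"
    by (simp add: inner_fock_def cinner_scaleC_left)
  show "0 \<le> inner f f"
    by (simp add: inner_fock_def cinner_self)
  have "f = 0" if "(\<integral>z. (norm (fock_fun f z))\<^sup>2 \<partial>gauss) = 0"
    using that by transfer (rule fock_space_eq_zero)
  then show "inner f f = 0 \<longleftrightarrow> f = 0"
    by (auto simp: inner_fock_def cinner_self zero_fock.rep_eq)
qed (fact norm_fock_def sgn_fock_def dist_fock_def uniformity_fock_def open_fock_def)+

end

lemma norm_fock: "norm f = sqrt (\<integral>z. (norm (fock_fun f z))\<^sup>2 \<partial>gauss)"
  by (simp add: norm_fock_def inner_fock_def cinner_self)

definition bounded_operators :: "(fock \<Rightarrow> fock) set" where
  "bounded_operators = {A. Vector_Spaces.linear scaleC scaleC A \<and> bounded_linear A}"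

text \<open>
  \<open>adjoint_of B A\<close> says that \<open>B\<close> is the Hilbert space adjoint of \<open>A\<close>. Every bounded operator has
  exactly one bounded adjoint, so quantifying over all bounded \<open>B\<close> with this property, as in the
  closure condition of \<open>von_neumann_algebra\<close>, refers to that single operator.
\<close>

definition adjoint_of :: "(fock \<Rightarrow> fock) \<Rightarrow> (fock \<Rightarrow> fock) \<Rightarrow> bool" where
  "adjoint_of B A \<longleftrightarrow> (\<forall>f g. cinner (A f) g = cinner f (B g))"

text \<open>
  The basic weak operator neighbourhoods of \<open>A\<close> are given by a finite set \<open>P\<close> of pairs of vectors and
  a radius \<open>e\<close>.
\<close>

definition wot_closed :: "(fock \<Rightarrow> fock) set \<Rightarrow> bool" where
  "wot_closed M \<longleftrightarrow>
    (\<forall>A\<in>bounded_operators.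
      (\<forall>P e. finite P \<and> e > 0 \<longrightarrow>
        (\<exists>B\<in>M. \<forall>(f, g)\<in>P. norm (cinner (A f - B f) g) < e)) \<longrightarrow> A \<in> M)"

definition von_neumann_algebra :: "(fock \<Rightarrow> fock) set \<Rightarrow> bool" where
  "von_neumann_algebra M \<longleftrightarrow>
    M \<subseteq> bounded_operators \<and>
    id \<in> M \<and>
    (\<forall>A\<in>M. \<forall>B\<in>M. (\<lambda>f. A f + B f) \<in> M) \<and>
    (\<forall>c. \<forall>A\<in>M. (\<lambda>f. c *\<^sub>C A f) \<in> M) \<and>
    (\<forall>A\<in>M. \<forall>B\<in>M. A \<circ> B \<in> M) \<and>
    (\<forall>A\<in>M. \<forall>B\<in>bounded_operators. adjoint_of B A \<longrightarrow> B \<in> M) \<and>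
    wot_closed M"

definition nkernel :: "complex \<Rightarrow> complex \<Rightarrow> complex" where
  "nkernel z w = exp (w * cnj z - (norm z)\<^sup>2 / 2)"

lemma of_real_norm_square: "(complex_of_real (norm u))\<^sup>2 = u * cnj u"
  by (metis complex_norm_square of_real_power)

lemma norm_nkernel_density:
  "(norm (nkernel z w))\<^sup>2 * exp (- (norm w)\<^sup>2) = exp (- (norm (w - z))\<^sup>2)"
proof -
  have "(norm (nkernel z w))\<^sup>2 = exp (2 * Re (w * cnj z) - (norm z)\<^sup>2)"
    by (simp add: nkernel_def exp_double[symmetric] algebra_simps)
  moreover have "2 * Re (w * cnj z) - (norm z)\<^sup>2 - (norm w)\<^sup>2 = - (norm (w - z))\<^sup>2"
    by (simp add: cmod_power2 power2_diff)
  ultimately show ?thesis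
    by (simp add: exp_add[symmetric])
qed

lemma integrable_lborel_shift:
  fixes F :: "complex \<Rightarrow> 'a :: {banach, second_countable_topology}"
  assumes [measurable]: "F \<in> borel_measurable borel"
  shows "integrable lborel (\<lambda>w. F (w - z)) \<longleftrightarrow> integrable lborel F"
    "(\<integral>w. F (w - z) \<partial>lborel) = (\<integral>w. F w \<partial>lborel)"
  using integrable_distr_eq[of "(+) (- z)" lborel borel F]
    integral_distr[of "(+) (- z)" lborel borel F]
  unfolding lborel_distr_plus by simp_all

lemma weyl_fock_space:
  assumes f: "f \<in> fock_space"
  shows "(\<lambda>w. nkernel z w * f (w - z)) \<in> fock_space"
proof -
  note [measurable] = fock_space_measurable[OF f]
  have hol: "(\<lambda>w. nkernel z w * f (w - z)) holomorphic_on UNIV"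
  proof -
    have "(\<lambda>w. f (w - z)) holomorphic_on UNIV"
      using holomorphic_on_compose_gen[of "\<lambda>w. w - z" UNIV f UNIV] f
      by (simp add: fock_space_def o_def holomorphic_intros)
    then show ?thesis
      unfolding nkernel_def by (auto intro!: holomorphic_intros)
  qed
  then have [measurable]: "(\<lambda>w. nkernel z w * f (w - z)) \<in> borel_measurable borel"
    by (intro borel_measurable_continuous_onI holomorphic_on_imp_continuous_on)
  let ?F = "\<lambda>w. exp (- (norm w)\<^sup>2) / pi * (norm (f w))\<^sup>2"
  have eq: "exp (- (norm w)\<^sup>2) / pi * (norm (nkernel z w * f (w - z)))\<^sup>2 = ?F (w - z)" for w
    using norm_nkernel_density[of z w] by (simp add: norm_mult power_mult_distrib mult_ac)
  have "integrable lborel ?F"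
    using f unfolding fock_space_def gauss_def
    by (simp add: integrable_density)
  then have "integrable lborel (\<lambda>w. ?F (w - z))"
    by (subst integrable_lborel_shift) auto
  then have "integrable gauss (\<lambda>w. (norm (nkernel z w * f (w - z)))\<^sup>2)"
    unfolding gauss_def by (subst integrable_density) (auto simp: eq simp flip: times_divide_eq_left)
  with hol show ?thesis
    by (simp add: fock_space_def)
qed

lift_definition weyl :: "complex \<Rightarrow> fock \<Rightarrow> fock" is "\<lambda>z f w. nkernel z w * f (w - z)"
  by (rule weyl_fock_space)

lemma weyl_adjoint: "adjoint_of (weyl (- z)) (weyl z)"
  unfolding adjoint_of_def
proof (intro allI, transfer)
  fix z f g assume fg: "f \<in> fock_space" "g \<in> fock_space"
  note [measurable] = fock_space_measurable[OF fg(1)] fock_space_measurable[OF fg(2)]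
  let ?d = "\<lambda>w::complex. exp (- (norm w)\<^sup>2) / pi"
  have [measurable]: "nkernel u \<in> borel_measurable borel" for u
    unfolding nkernel_def by measurable
  let ?G = "\<lambda>w. ?d w *\<^sub>R (f w * cnj (nkernel (- z) w * g (w - - z)))"
  have eq: "?d w *\<^sub>R (nkernel z w * f (w - z) * cnj (g w)) = ?G (w - z)" for w
  proof -
    have "complex_of_real (exp (- (norm w)\<^sup>2)) * nkernel z w
        = complex_of_real (exp (- (norm (w - z))\<^sup>2)) * cnj (nkernel (- z) (w - z))"
      unfolding nkernel_def exp_of_real[symmetric] exp_cnj exp_add[symmetric]
      by (rule arg_cong[where f = exp])
        (simp add: of_real_norm_square algebra_simps)
    then show ?thesis
      by (simp add: scaleR_conv_of_real field_simps)
  qed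
  have "(\<integral>w. nkernel z w * f (w - z) * cnj (g w) \<partial>gauss)
      = (\<integral>w. ?d w *\<^sub>R (nkernel z w * f (w - z) * cnj (g w)) \<partial>lborel)"
    unfolding gauss_def by (subst integral_density) auto
  also have "\<dots> = (\<integral>w. ?G w \<partial>lborel)"
    unfolding eq by (rule integrable_lborel_shift(2)) measurable
  also have "\<dots> = (\<integral>w. f w * cnj (nkernel (- z) w * g (w - - z)) \<partial>gauss)"
    unfolding gauss_def by (subst integral_density) auto
  finally show "(\<integral>w. nkernel z w * f (w - z) * cnj (g w) \<partial>gauss)
      = (\<integral>w. f w * cnj (nkernel (- z) w * g (w - - z)) \<partial>gauss)" .
qed

lemma weyl_inverse: "weyl z \<circ> weyl (- z) = id"
proof -
  have "nkernel z w * nkernel (- z) (w - z) = 1" for w z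
    unfolding nkernel_def exp_add[symmetric]
    by (simp add: of_real_norm_square algebra_simps)
  then show ?thesis
    unfolding fun_eq_iff o_def id_def
    by (intro allI, transfer) (simp add: fun_eq_iff mult.assoc[symmetric])
qed

text \<open>
  By \<open>weyl_adjoint\<close> and \<open>weyl_inverse\<close>, \<open>weyl (- z)\<close> is the adjoint and the inverse of \<open>weyl z\<close>.
\<close>

definition alpha :: "complex \<Rightarrow> (fock \<Rightarrow> fock) \<Rightarrow> fock \<Rightarrow> fock" where
  "alpha z A = weyl z \<circ> A \<circ> weyl (- z)"

definition vertical_operators :: "(fock \<Rightarrow> fock) set" where
  "vertical_operators = {A \<in> bounded_operators. \<forall>h::real. alpha (of_real h) A = A}"

lemma kernel_fock_space: "(\<lambda>w. exp (w * cnj u)) \<in> fock_space"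
proof -
  interpret prob_space gauss by (rule prob_space_gauss)
  have "(\<lambda>_. 1) \<in> fock_space"
    by (simp add: fock_space_def)
  then have "(\<lambda>w. of_real (exp ((norm u)\<^sup>2 / 2)) * (nkernel u w * 1)) \<in> fock_space"
    by (intro fock_space_mult weyl_fock_space[where f = "\<lambda>_. 1"])
  moreover have "of_real (exp ((norm u)\<^sup>2 / 2)) * (nkernel u w * 1) = exp (w * cnj u)" for w
    by (simp add: nkernel_def exp_of_real[symmetric] exp_add[symmetric])
  ultimately show ?thesis
    by simp
qed

lift_definition kernel :: "complex \<Rightarrow> fock" is "\<lambda>u w. exp (w * cnj u)"
  by (rule kernel_fock_space)

definition sing_int :: "fock \<Rightarrow> fock \<Rightarrow> complex \<Rightarrow> complex" where
  "sing_int \<phi> f z =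
    (\<integral>w. fock_fun f w * exp (z * cnj w) * fock_fun \<phi> (z - cnj w) \<partial>gauss)"

text \<open>
  The integral converges absolutely when \<open>f\<close> is a linear combination of kernels, because
  \<open>\<bar>\<phi>(\<zeta>)\<bar> \<le> \<parallel>\<phi>\<parallel> exp (\<bar>\<zeta>\<bar>\<^sup>2 / 2)\<close>. It need not converge for every \<open>f\<close> in the Fock space, so the
  operator with symbol \<open>\<phi>\<close> is initially defined on the complex linear span of the kernels only,
  and an everywhere defined bounded operator is identified with it when it extends it.
\<close>

definition extends_sing_int :: "fock \<Rightarrow> (fock \<Rightarrow> fock) \<Rightarrow> bool" where
  "extends_sing_int \<phi> A \<longleftrightarrow>
    (\<forall>f\<in>cfock.span (range kernel). fock_fun (A f) = sing_int \<phi> f)"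

definition bounded_singular_integral_operators :: "(fock \<Rightarrow> fock) set" where
  "bounded_singular_integral_operators =
    {A \<in> bounded_operators. \<exists>\<phi>. extends_sing_int \<phi> A}"

end

theory Submission
  imports Defs "HOL-Complex_Analysis.Complex_Analysis"
begin

text \<open>
  The reproducing formula gives \<open>(S\<^sub>\<phi> K\<^sub>u)(z) = exp (z * cnj u) * \<phi> (z - cnj u)\<close>, so a bounded
  operator \<open>A\<close> is \<open>S\<^sub>\<phi>\<close> iff \<open>F(z, v) = exp (- z * v) * (A K\<^bsub>cnj v\<^esub>)(z)\<close> is \<open>\<phi> (z - v)\<close>, a function
  of \<open>z - v\<close> alone. Conjugating \<open>A\<close> by a real Weyl translation \<open>h\<close> replaces \<open>F(z, v)\<close> by
  \<open>F(z - h, v - h)\<close>. Hence \<open>S\<^sub>\<phi>\<close> is vertical on the kernels, and everywhere because their span is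
  dense. Conversely, for vertical \<open>A\<close> the entire function \<open>h \<mapsto> F(z + h, v + h)\<close> is constant on the
  reals, hence on the plane, and \<open>h = - v\<close> yields \<open>\<phi> = A 1\<close>.
\<close>

section \<open>Rotation invariance of the Gaussian measure and the mean value property\<close>

lemma nn_integral_lborel_shift:
  fixes g :: "'a::euclidean_space \<Rightarrow> ennreal"
  assumes [measurable]: "g \<in> borel_measurable borel"
  shows "(\<integral>\<^sup>+x. g (a + x) \<partial>lborel) = (\<integral>\<^sup>+x. g x \<partial>lborel)"
  using nn_integral_distr[of "(+) a" lborel borel g] unfolding lborel_distr_plus by simp

text \<open>
  Uniqueness of Haar measure: two translation invariant measures are compared by integrating
  \<open>g (c * x) * h y\<close>, where the Gaussian weight \<open>h\<close> is even and rotation invariant.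
\<close>

lemma nn_integral_lborel_rotate:
  fixes c :: complex and g :: "complex \<Rightarrow> ennreal"
  assumes c: "norm c = 1" and g [measurable]: "g \<in> borel_measurable borel"
  shows "(\<integral>\<^sup>+x. g (c * x) \<partial>lborel) = (\<integral>\<^sup>+x. g x \<partial>lborel)"
proof -
  define h :: "complex \<Rightarrow> ennreal" where "h z = ennreal (exp (- (norm z)\<^sup>2) / pi)" for z
  have [measurable]: "h \<in> borel_measurable borel"
    unfolding h_def by measurable
  have h_rot: "h (c * z) = h z" for z
    using c by (simp add: h_def norm_mult)
  have h_minus: "h (x - y) = h (y - x)" for x y
    by (simp add: h_def norm_minus_commute)
  interpret prob_space gauss by (rule prob_space_gauss)
  have one: "(\<integral>\<^sup>+z. h z \<partial>lborel) = 1"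
    using emeasure_space_1 by (simp add: gauss_def emeasure_density h_def)
  have "(\<integral>\<^sup>+x. g (c * x) \<partial>lborel) = (\<integral>\<^sup>+x. (\<integral>\<^sup>+y. g (c * x) * h y \<partial>lborel) \<partial>lborel)"
    by (simp add: nn_integral_cmult one)
  also have "\<dots> = (\<integral>\<^sup>+y. (\<integral>\<^sup>+x. g (c * x) * h y \<partial>lborel) \<partial>lborel)"
    by (rule lborel_pair.Fubini'[symmetric]) measurable
  also have "\<dots> = (\<integral>\<^sup>+y. (\<integral>\<^sup>+x. g (c * (inverse c * y + x)) * h y \<partial>lborel) \<partial>lborel)"
    by (intro nn_integral_cong nn_integral_lborel_shift[symmetric]) measurable
  also have "\<dots> = (\<integral>\<^sup>+y. (\<integral>\<^sup>+x. g (c * x + y) * h y \<partial>lborel) \<partial>lborel)"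
    using c by (intro nn_integral_cong) (auto simp: field_simps)
  also have "\<dots> = (\<integral>\<^sup>+x. (\<integral>\<^sup>+y. g (c * x + y) * h y \<partial>lborel) \<partial>lborel)"
    by (rule lborel_pair.Fubini') measurable
  also have "\<dots> = (\<integral>\<^sup>+x. (\<integral>\<^sup>+y. g (c * x + (- (c * x) + y)) * h (- (c * x) + y) \<partial>lborel) \<partial>lborel)"
    by (intro nn_integral_cong nn_integral_lborel_shift[symmetric]) measurable
  also have "\<dots> = (\<integral>\<^sup>+x. (\<integral>\<^sup>+y. g y * h (y - c * x) \<partial>lborel) \<partial>lborel)"
    by simp
  also have "\<dots> = (\<integral>\<^sup>+y. (\<integral>\<^sup>+x. g y * h (y - c * x) \<partial>lborel) \<partial>lborel)"
    by (rule lborel_pair.Fubini'[symmetric]) measurable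
  also have "\<dots> = (\<integral>\<^sup>+y. (\<integral>\<^sup>+x. g y * h (- (inverse c * y) + x) \<partial>lborel) \<partial>lborel)"
  proof -
    \<comment> \<open>Evenness and rotation invariance of \<open>h\<close> absorb the rotation: what
      remains is a translate of \<open>h\<close> in \<open>x\<close>, of integral 1.\<close>
    have "h (y - c * x) = h (- (inverse c * y) + x)" for x y
    proof -
      have "c * (- (inverse c * y) + x) = c * x - y"
        using c by (auto simp: field_simps)
      then show ?thesis
        by (metis h_rot h_minus)
    qed
    then show ?thesis by simp
  qed
  also have "\<dots> = (\<integral>\<^sup>+y. g y * (\<integral>\<^sup>+x. h (- (inverse c * y) + x) \<partial>lborel) \<partial>lborel)"
    by (intro nn_integral_cong nn_integral_cmult) measurable
  also have "\<dots> = (\<integral>\<^sup>+y. g y \<partial>lborel)"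
    using nn_integral_lborel_shift[of h "- (inverse c * y)" for y] by (simp add: one)
  finally show ?thesis .
qed

lemma gauss_distr_rotate:
  assumes c: "norm c = 1"
  shows "distr gauss borel ((*) c) = gauss"
proof (rule measure_eqI)
  fix A assume "A \<in> sets (distr gauss borel ((*) c))"
  then have [measurable]: "A \<in> sets borel" by simp
  have "emeasure (distr gauss borel ((*) c)) A
      = (\<integral>\<^sup>+z. ennreal (exp (- (norm z)\<^sup>2) / pi) * indicator ((*) c -` A) z \<partial>lborel)"
    unfolding gauss_def
    by (subst emeasure_distr, simp, simp, subst emeasure_density)
      (simp_all add: measurable_sets_borel[of _ borel])
  also have "\<dots> = (\<integral>\<^sup>+z. ennreal (exp (- (norm (c * z))\<^sup>2) / pi) * indicator A (c * z) \<partial>lborel)"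
    using c by (intro nn_integral_cong) (auto simp: norm_mult indicator_def)
  also have "\<dots> = emeasure gauss A"
    by (subst nn_integral_lborel_rotate[OF c]) (simp_all add: gauss_def emeasure_density)
  finally show "emeasure (distr gauss borel ((*) c)) A = emeasure gauss A" .
qed simp

text \<open>Cauchy's formula at the centre of the unit circle, applied to
  \<open>u \<mapsto> f (u * w)\<close> rather than to \<open>f\<close>: the radius is hidden in
  \<open>w\<close>, which may then be zero.\<close>

lemma circle_mean_value:
  assumes f: "f holomorphic_on UNIV"
  shows "((\<lambda>t. f (cis (2 * pi * t) * w)) has_integral f 0) {0..1}"
proof -
  have hol: "(\<lambda>u. f (u * w)) holomorphic_on UNIV"
    using holomorphic_on_compose_gen[of "\<lambda>u. u * w" UNIV f UNIV] f
    by (simp add: o_def holomorphic_intros)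
  have "((\<lambda>u. f (u * w) / (u - 0)) has_contour_integral (2 * of_real pi * \<i> * f (0 * w))) (circlepath 0 1)"
    by (rule Cauchy_integral_circlepath)
       (auto intro: holomorphic_on_subset[OF hol] holomorphic_on_imp_continuous_on)
  then have "((\<lambda>t. 2 * of_real pi * \<i> * f (cis (2 * pi * t) * w)) has_integral
      2 * of_real pi * \<i> * f (0 * w)) {0..1}"
    unfolding has_contour_integral
  proof (rule has_integral_eq[rotated])
    fix t :: real assume "t \<in> {0..1}"
    then have "vector_derivative (circlepath 0 1) (at t) = 2 * of_real pi * \<i> * exp (2 * of_real pi * \<i> * t)"
      by (simp add: vector_derivative_circlepath)
    moreover have "circlepath 0 1 t = cis (2 * pi * t)" "exp (2 * of_real pi * \<i> * t) = cis (2 * pi * t)"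
      by (simp_all add: circlepath cis_conv_exp mult_ac)
    ultimately show "f (circlepath 0 1 t * w) / (circlepath 0 1 t - 0) * vector_derivative (circlepath 0 1) (at t)
        = 2 * of_real pi * \<i> * f (cis (2 * pi * t) * w)"
      by simp
  qed
  from has_integral_mult_right[OF this, of "inverse (2 * of_real pi * \<i>)"]
  show ?thesis
    by (simp add: field_simps)
qed

text \<open>A rotation of the argument leaves the integral unchanged, so the integral equals its
  average over all rotations. By Fubini the average can be taken first at each \<open>w\<close>,
  where it is \<open>f 0\<close>.\<close>

lemma gauss_mean_value:
  assumes f: "f holomorphic_on UNIV" and int: "integrable gauss f"
  shows "(\<integral>w. f w \<partial>gauss) = f 0"
proof -
  have cont: "continuous_on UNIV f"
    using f by (rule holomorphic_on_imp_continuous_on)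
  have [measurable]: "f \<in> borel_measurable borel"
    using cont by (rule borel_measurable_continuous_onI)
  have [measurable]: "(\<lambda>t. cis (2 * pi * t)) \<in> borel_measurable borel"
    by (intro borel_measurable_continuous_onI continuous_intros)
  let ?F = "\<lambda>t w. indicat_real {0..1} t *\<^sub>R f (cis (2 * pi * t) * w)"
  interpret prob_space gauss by (rule prob_space_gauss)
  interpret pair_sigma_finite "lborel :: real measure" gauss
    by (intro pair_sigma_finite.intro sigma_finite_lborel prob_space_imp_sigma_finite prob_space_gauss)
  have rot: "(\<integral>w. g (cis a * w) \<partial>gauss) = (\<integral>w. g w \<partial>gauss)"
    if [measurable]: "g \<in> borel_measurable borel"
    for a and g :: "complex \<Rightarrow> 'a::{banach, second_countable_topology}"
    using integral_distr[of "(*) (cis a)" gauss borel g] gauss_distr_rotate[of "cis a"] by simp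
  have introt: "integrable gauss (\<lambda>w. f (cis a * w))" for a
    using integrable_distr_eq[of "(*) (cis a)" gauss borel f] gauss_distr_rotate[of "cis a"] int
    by simp
  have "integrable (lborel \<Otimes>\<^sub>M gauss) (case_prod ?F)"
  proof (rule Fubini_integrable)
    \<comment> \<open>By rotation invariance the inner integral is constant for \<open>t\<close> in
      \<open>{0..1}\<close> and zero elsewhere.\<close>
    show "integrable lborel (\<lambda>t. \<integral>w. norm (case (t, w) of (t, w) \<Rightarrow> ?F t w) \<partial>gauss)"
      using rot[of "\<lambda>w. norm (f w)"] by (simp add: integrable_real_mult_indicator)
  qed (use introt in auto)
  then have "(\<integral>t. (\<integral>w. ?F t w \<partial>gauss) \<partial>lborel) = (\<integral>w. (\<integral>t. ?F t w \<partial>lborel) \<partial>gauss)"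
    by (rule Fubini_integral[symmetric])
  moreover have "(\<integral>t. ?F t w \<partial>lborel) = f 0" for w
  proof -
    have "set_integrable lborel {0..1} (\<lambda>t. f (cis (2 * pi * t) * w))"
      unfolding set_integrable_def
      by (rule borel_integrable_compact)
         (auto intro!: continuous_intros continuous_on_compose2[OF cont])
    from set_borel_integral_eq_integral(2)[OF this] show ?thesis
      using circle_mean_value[OF f, of w] by (simp add: set_lebesgue_integral_def integral_unique)
  qed
  moreover have "(\<integral>t. (\<integral>w. ?F t w \<partial>gauss) \<partial>lborel) = (\<integral>w. f w \<partial>gauss)"
    using rot[of f] by simp
  ultimately show ?thesis
    using prob_space by simp
qed

text \<open>
  Only integrability of the product is assumed: the function \<open>w \<mapsto> cnj (exp (z * cnj w) * \<phi> (z - cnj w))\<close>,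
  to which the formula is applied in \<open>sing_int_kernel\<close>, need not be square integrable.
\<close>

lemma gauss_reproducing:
  assumes h: "h holomorphic_on UNIV"
    and int: "integrable gauss (\<lambda>w. h w * cnj (exp (w * cnj u)))"
  shows "(\<integral>w. h w * cnj (exp (w * cnj u)) \<partial>gauss) = h u"
proof -
  let ?d = "\<lambda>w::complex. exp (- (norm w)\<^sup>2) / pi"
  let ?F = "\<lambda>w. ?d w *\<^sub>R (h w * cnj (exp (w * cnj u)))"
  have hol: "(\<lambda>w. h (w + u) * exp (- w * cnj u)) holomorphic_on UNIV"
  proof -
    have "(\<lambda>w. h (w + u)) holomorphic_on UNIV"
      using holomorphic_on_compose_gen[of "\<lambda>w. w + u" UNIV h UNIV] h
      by (simp add: o_def holomorphic_intros)
    then show ?thesis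
      by (intro holomorphic_intros)
  qed
  have [measurable]: "h \<in> borel_measurable borel"
    "(\<lambda>w. h (w + u) * exp (- w * cnj u)) \<in> borel_measurable borel"
    using h hol by (auto intro!: borel_measurable_continuous_onI holomorphic_on_imp_continuous_on)
  \<comment> \<open>Translation by \<open>u\<close> completes the square: the weight absorbs the
    antiholomorphic factor and leaves a holomorphic one, so the mean value property applies.\<close>
  have eq: "?F (w - - u) = ?d w *\<^sub>R (h (w + u) * exp (- w * cnj u))" for w
  proof -
    have "of_real (exp (- (norm (w + u))\<^sup>2)) * cnj (exp ((w + u) * cnj u))
        = of_real (exp (- (norm w)\<^sup>2)) * exp (- w * cnj u)"
      unfolding exp_of_real[symmetric] exp_cnj exp_add[symmetric]
      by (rule arg_cong[where f = exp]) (simp add: of_real_norm_square algebra_simps)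
    then show ?thesis
      by (simp add: scaleR_conv_of_real field_simps)
  qed
  have "integrable lborel ?F"
    using int by (simp add: gauss_def integrable_density)
  then have "integrable lborel (\<lambda>w. ?F (w - - u))"
    by (subst integrable_lborel_shift(1)) auto
  then have gm: "integrable gauss (\<lambda>w. h (w + u) * exp (- w * cnj u))"
    unfolding eq by (simp add: gauss_def integrable_density)
  have "(\<integral>w. h w * cnj (exp (w * cnj u)) \<partial>gauss) = (\<integral>w. ?F w \<partial>lborel)"
    unfolding gauss_def by (subst integral_density) auto
  also have "\<dots> = (\<integral>w. ?F (w - - u) \<partial>lborel)"
    by (rule integrable_lborel_shift(2)[symmetric]) measurable
  also have "\<dots> = (\<integral>w. h (w + u) * exp (- w * cnj u) \<partial>gauss)"
    unfolding eq gauss_def by (subst integral_density) auto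
  also have "\<dots> = h u"
    using gauss_mean_value[OF hol gm] by simp
  finally show ?thesis .
qed

section \<open>Dominating functions for the Gaussian measure\<close>

lemma integrable_exp_norm_square:
  fixes c :: real
  assumes "c > 0"
  shows "integrable lborel (\<lambda>w::complex. exp (- c * (norm w)\<^sup>2))"
proof -
  interpret prob_space gauss by (rule prob_space_gauss)
  have "integrable gauss (\<lambda>_. 1::real)" by simp
  then have "integrable lborel (\<lambda>w::complex. exp (- (norm w)\<^sup>2) / pi * 1)"
    unfolding gauss_def by (subst (asm) integrable_density) auto
  then have "integrable lborel (\<lambda>w::complex. pi * (exp (- (norm w)\<^sup>2) / pi))"
    by (intro integrable_mult_right) simp
  then have "integrable lborel (\<lambda>w::complex. exp (- (norm w)\<^sup>2))"
    by simp
  \<comment> \<open>Lebesgue measure is rewritten as its image under scaling by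
    \<open>sqrt c\<close>, with Jacobian \<open>c\<close>; this reduces the claim to the case
    \<open>c = 1\<close>.\<close>
  then have "integrable (density (distr lborel borel (\<lambda>x. 0 + sqrt c *\<^sub>R x)) (\<lambda>_. ennreal (\<bar>sqrt c\<bar> ^ DIM(complex))))
      (\<lambda>w::complex. exp (- (norm w)\<^sup>2))"
    using assms lborel_affine[of "sqrt c" "0 :: complex"] by (simp add: ennreal_power)
  then have "integrable lborel (\<lambda>w::complex. c * exp (- c * (norm w)\<^sup>2))"
    using assms
    by (subst (asm) integrable_density) (auto simp: integrable_distr_eq power_mult_distrib)
  then show ?thesis
    using assms by simp
qed

text \<open>Supplies the dominating functions: \<open>a = 1/2\<close> for the singular integral on
  kernels, \<open>a = 0\<close> for monomials and Taylor remainders.\<close>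

lemma integrable_gauss_exp_norm:
  assumes "a < 1"
  shows "integrable gauss (\<lambda>w. exp (a * (norm w)\<^sup>2 + b * norm w))"
proof -
  \<comment> \<open>Half of the gap \<open>1 - a\<close>: one half absorbs the linear term, the
    other half remains as Gaussian decay.\<close>
  define c where "c = (1 - a) / 2"
  have c: "c > 0" using assms by (simp add: c_def)
  have bound: "exp (- (norm w)\<^sup>2) / pi * exp (a * (norm w)\<^sup>2 + b * norm w)
      \<le> exp (b\<^sup>2 / (4 * c)) / pi * exp (- c * (norm w)\<^sup>2)" for w :: complex
  proof -
    have "0 \<le> (2 * c * norm w - b)\<^sup>2" by simp
    then have "b * norm w \<le> c * (norm w)\<^sup>2 + b\<^sup>2 / (4 * c)"
      using c by (simp add: power2_diff field_simps power2_eq_square)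
    then have "- (norm w)\<^sup>2 + (a * (norm w)\<^sup>2 + b * norm w) \<le> b\<^sup>2 / (4 * c) + - c * (norm w)\<^sup>2"
      by (simp add: c_def algebra_simps add_divide_distrib diff_divide_distrib)
    then show ?thesis
      by (simp add: exp_add[symmetric] divide_right_mono)
  qed
  have "integrable lborel (\<lambda>w::complex. exp (- (norm w)\<^sup>2) / pi * exp (a * (norm w)\<^sup>2 + b * norm w))"
  proof (rule Bochner_Integration.integrable_bound)
    show "integrable lborel (\<lambda>w::complex. exp (b\<^sup>2 / (4 * c)) / pi * exp (- c * (norm w)\<^sup>2))"
      using integrable_exp_norm_square[OF c] by (rule integrable_mult_right)
    show "AE w in lborel. norm (exp (- (norm (w::complex))\<^sup>2) / pi * exp (a * (norm w)\<^sup>2 + b * norm w))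
        \<le> norm (exp (b\<^sup>2 / (4 * c)) / pi * exp (- c * (norm w)\<^sup>2))"
      using bound by (auto simp: abs_mult)
  qed simp
  then show ?thesis
    unfolding gauss_def by (subst integrable_density) auto
qed

section \<open>Reproducing kernels and pointwise bounds\<close>

lemma cinner_diff_left: "cinner (f - g) h = cinner f h - cinner g h"
  using cinner_add_left[of "f - g" g h] by simp

lemma cinner_scaleC_right: "cinner f (c *\<^sub>C g) = cnj c * cinner f g"
  by (subst (1 2) cinner_commute) (simp add: cinner_scaleC_left)

lemma weyl_kernel:
  "weyl z (kernel u) = exp (- (norm z)\<^sup>2 / 2 - z * cnj u) *\<^sub>C kernel (u + z)"
  by transfer (simp add: nkernel_def exp_add[symmetric] fun_eq_iff algebra_simps)

lemma cinner_kernel: "cinner f (kernel z) = fock_fun f z"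
  by transfer (simp add: fock_space_def gauss_reproducing
      fock_space_integrable_cnj[OF _ kernel_fock_space])

lemma norm_scaleC: "norm (c *\<^sub>C f) = norm c * norm f"
  by (simp add: norm_fock scaleC.rep_eq norm_mult power_mult_distrib real_sqrt_mult)

lemma norm_kernel: "norm (kernel z) = exp ((norm z)\<^sup>2 / 2)"
proof -
  have "(norm (kernel z))\<^sup>2 = exp ((norm z)\<^sup>2)"
    unfolding power2_norm_eq_inner[of "kernel z"] inner_fock_def cinner_kernel
    by (simp add: kernel.rep_eq of_real_norm_square[symmetric] exp_of_real flip: of_real_power)
  also have "\<dots> = (exp ((norm z)\<^sup>2 / 2))\<^sup>2"
    by (simp add: exp_double[symmetric])
  finally show ?thesis
    by (simp add: power2_eq_iff_nonneg)
qed

text \<open>Cauchy-Schwarz against \<open>kernel z\<close>. Convergence in norm is therefore uniform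
  on discs, which keeps limits holomorphic.\<close>

lemma norm_fock_fun_le: "norm (fock_fun f z) \<le> norm f * exp ((norm z)\<^sup>2 / 2)"
proof -
  \<comment> \<open>\<open>inner\<close> is only the real part of \<open>cinner\<close>, so the
    value is first rotated onto the nonnegative real axis.\<close>
  obtain c where c: "norm c = 1" "c * fock_fun f z = of_real (norm (fock_fun f z))"
  proof (cases "fock_fun f z = 0")
    case False
    have "cnj (fock_fun f z) * fock_fun f z = of_real (norm (fock_fun f z)) * of_real (norm (fock_fun f z))"
      by (metis of_real_norm_square mult.commute power2_eq_square)
    with False show ?thesis
      by (intro that[of "cnj (fock_fun f z) / of_real (norm (fock_fun f z))"])
        (auto simp: norm_divide)
  qed (use that[of 1] in auto)
  then have "norm (fock_fun f z) = inner (c *\<^sub>C f) (kernel z)"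
    by (simp add: inner_fock_def cinner_kernel scaleC.rep_eq)
  also have "\<dots> \<le> norm f * exp ((norm z)\<^sup>2 / 2)"
    using norm_cauchy_schwarz[of "c *\<^sub>C f" "kernel z"] c by (simp add: norm_scaleC norm_kernel)
  finally show ?thesis .
qed

lemma nn_integral_fock:
  "(\<integral>\<^sup>+z. ennreal ((norm (fock_fun f z))\<^sup>2) \<partial>gauss) = ennreal ((norm f)\<^sup>2)"
proof -
  have "integrable gauss (\<lambda>z. (norm (fock_fun f z))\<^sup>2)"
    using fock_fun[of f] by (simp add: fock_space_def)
  then show ?thesis
    by (simp add: nn_integral_eq_integral norm_fock)
qed

lemma measurable_fock_fun [measurable]: "fock_fun f \<in> borel_measurable borel"
  using fock_fun by (rule fock_space_measurable)

lemma holomorphic_fock_fun: "fock_fun f holomorphic_on UNIV"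
  using fock_fun[of f] by (simp add: fock_space_def)

section \<open>Completeness of the Fock space\<close>

text \<open>Fatou's lemma carries the norm bound to the limit. In the completeness proof it is
  applied to differences \<open>X m - X n\<close>, where it yields both membership and
  convergence.\<close>

lemma fock_space_pointwise_limit:
  assumes hol: "h holomorphic_on UNIV"
    and lim: "\<And>z. (\<lambda>m. fock_fun (Y m) z) \<longlonglongrightarrow> h z"
    and bound: "eventually (\<lambda>m. norm (Y m) \<le> e) sequentially"
  shows "h \<in> fock_space" "norm (Abs_fock h) \<le> e"
proof -
  have [measurable]: "h \<in> borel_measurable borel"
    using hol by (intro borel_measurable_continuous_onI holomorphic_on_imp_continuous_on)
  have "\<exists>m. norm (Y m) \<le> e"
    using eventually_happens[OF bound] by simp
  then have e: "0 \<le> e"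
    using norm_ge_zero order_trans by blast
  have "(\<integral>\<^sup>+z. ennreal ((norm (h z))\<^sup>2) \<partial>gauss)
      = (\<integral>\<^sup>+z. liminf (\<lambda>m. ennreal ((norm (fock_fun (Y m) z))\<^sup>2)) \<partial>gauss)"
    by (intro nn_integral_cong lim_imp_Liminf[symmetric] tendsto_intros lim) simp
  also have "\<dots> \<le> liminf (\<lambda>m. \<integral>\<^sup>+z. ennreal ((norm (fock_fun (Y m) z))\<^sup>2) \<partial>gauss)"
    by (intro nn_integral_liminf) measurable
  also have "\<dots> \<le> ennreal (e\<^sup>2)"
    unfolding nn_integral_fock
    by (rule Liminf_le) (use bound in \<open>auto elim!: eventually_mono intro!: ennreal_leI power_mono\<close>)
  finally have le: "(\<integral>\<^sup>+z. ennreal ((norm (h z))\<^sup>2) \<partial>gauss) \<le> ennreal (e\<^sup>2)" .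
  have "integrable gauss (\<lambda>z. (norm (h z))\<^sup>2)"
    using le_less_trans[OF le ennreal_less_top] by (intro integrableI_nonneg) auto
  with hol show h: "h \<in> fock_space"
    by (simp add: fock_space_def)
  have "(norm (Abs_fock h))\<^sup>2 \<le> e\<^sup>2"
    using le nn_integral_fock[of "Abs_fock h"] h by (simp add: Abs_fock_inverse)
  then show "norm (Abs_fock h) \<le> e"
    using e by (rule power2_le_imp_le)
qed

text \<open>Point evaluations are bounded, locally uniformly in the point. A Cauchy sequence thus
  converges uniformly on discs to an entire function, and Fatou's lemma makes this the limit in
  norm.\<close>

instance fock :: complete_space
proof
  fix X :: "nat \<Rightarrow> fock" assume X: "Cauchy X"
  define E where "E z = exp ((norm z)\<^sup>2 / 2)" for z :: complex
  have E: "0 < E z" for z by (simp add: E_def)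
  have pointwise: "norm (fock_fun f z - fock_fun g z) \<le> norm (f - g) * E z" for f g z
    using norm_fock_fun_le[of "f - g" z] by (simp add: minus_fock.rep_eq E_def)
  have "Cauchy (\<lambda>n. fock_fun (X n) z)" for z
  proof (rule metric_CauchyI)
    fix e :: real assume "0 < e"
    then have "0 < e / E z" using E by simp
    from metric_CauchyD[OF X this] obtain M
      where M: "\<And>m n. m \<ge> M \<Longrightarrow> n \<ge> M \<Longrightarrow> norm (X m - X n) < e / E z"
      unfolding dist_norm by blast
    have "dist (fock_fun (X m) z) (fock_fun (X n) z) < e" if "m \<ge> M" "n \<ge> M" for m n
      using M[OF that] pointwise[of "X m" z "X n"] E[of z] by (simp add: dist_norm field_simps)
    then show "\<exists>M. \<forall>m\<ge>M. \<forall>n\<ge>M. dist (fock_fun (X m) z) (fock_fun (X n) z) < e"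
      by blast
  qed
  then have "\<exists>l. (\<lambda>n. fock_fun (X n) z) \<longlonglongrightarrow> l" for z
    using Cauchy_convergent convergent_def by blast
  then obtain f where f: "\<And>z. (\<lambda>n. fock_fun (X n) z) \<longlonglongrightarrow> f z"
    by metis
  have near: "norm (fock_fun (X n) z - f z) \<le> e * E z"
    if "\<And>m. m \<ge> n \<Longrightarrow> norm (X n - X m) \<le> e" for n z e
  proof (rule Lim_bounded)
    show "(\<lambda>m. norm (fock_fun (X n) z - fock_fun (X m) z)) \<longlonglongrightarrow> norm (fock_fun (X n) z - f z)"
      by (intro tendsto_intros f)
    show "\<forall>m\<ge>n. norm (fock_fun (X n) z - fock_fun (X m) z) \<le> e * E z"
      using that E pointwise by (meson order_trans mult_right_mono less_imp_le)
  qed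
  have hol: "f holomorphic_on UNIV"
  proof (rule holomorphic_uniform_sequence)
    fix z :: complex
    \<comment> \<open>A bound for \<open>E\<close> on the unit disc about \<open>z\<close>, which
      makes the estimate \<open>near\<close> uniform there.\<close>
    define R where "R = exp ((norm z + 1)\<^sup>2 / 2)"
    have R: "E x \<le> R" if "x \<in> cball z 1" for x
    proof -
      have "norm x \<le> norm z + 1"
        using that norm_triangle_ineq2[of x z] by (simp add: dist_norm norm_minus_commute)
      then show ?thesis by (simp add: E_def R_def power_mono)
    qed
    have "uniform_limit (cball z 1) (\<lambda>n. fock_fun (X n)) f sequentially"
    proof (rule uniform_limitI)
      fix e :: real assume "0 < e"
      then have "0 < e / (2 * R)" by (simp add: R_def)
      from metric_CauchyD[OF X this] obtain M
        where M: "\<And>m n. m \<ge> M \<Longrightarrow> n \<ge> M \<Longrightarrow> norm (X m - X n) < e / (2 * R)"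
        unfolding dist_norm by blast
      have "dist (fock_fun (X n) x) (f x) < e" if "n \<ge> M" "x \<in> cball z 1" for n x
      proof -
        have "norm (fock_fun (X n) x - f x) \<le> e / (2 * R) * E x"
          using that by (intro near less_imp_le[OF M]) auto
        also have "\<dots> \<le> e / (2 * R) * R"
          using R[OF that(2)] \<open>0 < e / (2 * R)\<close> by (intro mult_left_mono) auto
        also have "\<dots> < e"
          using \<open>0 < e\<close> by (simp add: R_def)
        finally show ?thesis by (simp add: dist_norm)
      qed
      then show "\<forall>\<^sub>F n in sequentially. \<forall>x\<in>cball z 1. dist (fock_fun (X n) x) (f x) < e"
        unfolding eventually_sequentially by blast
    qed
    then show "\<exists>d>0. cball z d \<subseteq> UNIV \<and> uniform_limit (cball z d) (\<lambda>n. fock_fun (X n)) f sequentially"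
      by (intro exI[of _ 1]) auto
  qed (auto simp: holomorphic_fock_fun)
  have diff: "(\<lambda>z. f z - fock_fun (X n) z) \<in> fock_space
      \<and> norm (Abs_fock (\<lambda>z. f z - fock_fun (X n) z)) \<le> e"
    if "\<And>m. m \<ge> n \<Longrightarrow> norm (X m - X n) \<le> e" for n e
    using that f hol
    by (intro conjI fock_space_pointwise_limit[where Y = "\<lambda>m. X m - X n"])
      (auto simp: minus_fock.rep_eq eventually_sequentially
        intro!: holomorphic_intros holomorphic_fock_fun tendsto_intros)
  \<comment> \<open>Any tolerance would serve: once one difference \<open>f - X M\<close> lies in
    the space, so does \<open>f\<close>.\<close>
  obtain M where "\<And>m. m \<ge> M \<Longrightarrow> norm (X m - X M) \<le> 1"
    using metric_CauchyD[OF X, of 1] unfolding dist_norm by (metis less_imp_le order_refl zero_less_one)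
  then have "(\<lambda>z. f z - fock_fun (X M) z) \<in> fock_space"
    using diff by blast
  from fock_space_add[OF this fock_fun[of "X M"]] have fsp: "f \<in> fock_space"
    by simp
  \<comment> \<open>\<open>Abs_fock\<close> is meaningful only on \<open>fock_space\<close>. Now
    that \<open>f\<close> is known to lie there, the difference can be formed in the type.\<close>
  have Abs: "Abs_fock (\<lambda>z. f z - fock_fun (X n) z) = Abs_fock f - X n" for n
    by (rule fock_fun_inject[THEN iffD1])
      (use fsp fock_space_add[OF fsp fock_space_mult[OF fock_fun[of "X n"], of "-1"]] in
        \<open>simp add: minus_fock.rep_eq Abs_fock_inverse\<close>)
  have "X \<longlonglongrightarrow> Abs_fock f"
  proof (rule metric_LIMSEQ_I)
    fix e :: real assume e: "0 < e"
    then obtain M where M: "\<And>m n. m \<ge> M \<Longrightarrow> n \<ge> M \<Longrightarrow> norm (X m - X n) < e / 2"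
      using metric_CauchyD[OF X, of "e / 2"] unfolding dist_norm by auto
    have "dist (X n) (Abs_fock f) < e" if "n \<ge> M" for n
    proof -
      have "norm (Abs_fock f - X n) \<le> e / 2"
        using diff[of n "e / 2"] M that by (force simp: Abs intro: less_imp_le)
      with e show ?thesis by (simp add: dist_norm norm_minus_commute)
    qed
    then show "\<exists>M. \<forall>n\<ge>M. dist (X n) (Abs_fock f) < e" by blast
  qed
  then show "convergent X"
    by (rule convergentI)
qed

section \<open>Orthogonal complements and density of the kernels\<close>

text \<open>The vector is \<open>g - p\<close> for a point \<open>p\<close> of \<open>M\<close>
  nearest to \<open>g\<close>. A minimising sequence is Cauchy by the parallelogram law, and
  minimality forces orthogonality.\<close>

lemma closed_subspace_orthogonal:
  fixes M :: "'a::{real_inner, complete_space} set"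
  assumes "closed M" "subspace M" "g \<notin> M"
  obtains f where "f \<noteq> 0" "\<And>m. m \<in> M \<Longrightarrow> inner f m = 0"
proof -
  define D where "D = (INF m\<in>M. (norm (g - m))\<^sup>2)"
  have bdd: "bdd_below ((\<lambda>m. (norm (g - m))\<^sup>2) ` M)"
    by (rule bdd_belowI2[of _ 0]) simp
  have D: "D \<le> (norm (g - m))\<^sup>2" if "m \<in> M" for m
    unfolding D_def using bdd that by (rule cINF_lower)
  have "0 \<in> M" using assms by (simp add: subspace_0)
  have "\<exists>m\<in>M. (norm (g - m))\<^sup>2 < D + 1 / real (Suc k)" for k
  proof -
    have "Inf ((\<lambda>m. (norm (g - m))\<^sup>2) ` M) < D + 1 / real (Suc k)"
      by (simp add: D_def)
    from cInf_lessD[OF _ this] \<open>0 \<in> M\<close> show ?thesis by blast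
  qed
  then obtain x where x: "\<And>k. x k \<in> M" "\<And>k. (norm (g - x k))\<^sup>2 < D + 1 / real (Suc k)"
    by metis
  have "Cauchy x"
  proof (rule CauchyI)
    fix e :: real assume "0 < e"
    then obtain N where N: "1 / real (Suc N) < e\<^sup>2 / 4"
      by (metis nat_approx_posE divide_pos_pos zero_less_numeral zero_less_power)
    have "norm (x m - x n) < e" if "m \<ge> N" "n \<ge> N" for m n
    proof -
      \<comment> \<open>The midpoint cannot beat the infimum \<open>D\<close>; the parallelogram law
        turns this into a bound on \<open>x m - x n\<close>.\<close>
      have "(1/2) *\<^sub>R (x m + x n) \<in> M"
        using assms x by (simp add: subspace_add subspace_scale)
      from D[OF this] have "4 * D \<le> (norm (2 *\<^sub>R (g - (1/2) *\<^sub>R (x m + x n))))\<^sup>2"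
        by (simp add: power_mult_distrib)
      also have "2 *\<^sub>R (g - (1/2) *\<^sub>R (x m + x n)) = (g - x m) + (g - x n)"
        by (simp add: algebra_simps scaleR_2)
      also have "(norm \<dots>)\<^sup>2 = 2 * (norm (g - x m))\<^sup>2 + 2 * (norm (g - x n))\<^sup>2 - (norm (x m - x n))\<^sup>2"
        by (simp add: power2_norm_eq_inner inner_simps inner_commute algebra_simps)
      finally have "(norm (x m - x n))\<^sup>2
          \<le> 2 * (norm (g - x m))\<^sup>2 + 2 * (norm (g - x n))\<^sup>2 - 4 * D" by simp
      also have "\<dots> < 2 * (1 / real (Suc m)) + 2 * (1 / real (Suc n))"
        using x(2)[of m] x(2)[of n] by simp
      also have "\<dots> \<le> 2 * (1 / real (Suc N)) + 2 * (1 / real (Suc N))"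
        using that by (intro add_mono mult_left_mono frac_le) auto
      also have "\<dots> < e\<^sup>2" using N by simp
      finally show ?thesis
        using \<open>0 < e\<close> by (simp add: power2_less_imp_less)
    qed
    then show "\<exists>M. \<forall>m\<ge>M. \<forall>n\<ge>M. norm (x m - x n) < e" by blast
  qed
  then obtain p where p: "x \<longlonglongrightarrow> p"
    using Cauchy_convergent convergent_def by blast
  have pM: "p \<in> M"
    using closed_sequentially[OF assms(1)] x(1) p by blast
  have "(norm (g - p))\<^sup>2 \<le> D + 0"
  proof (rule LIMSEQ_le)
    show "(\<lambda>k. (norm (g - x k))\<^sup>2) \<longlonglongrightarrow> (norm (g - p))\<^sup>2"
      by (intro tendsto_intros p)
    show "(\<lambda>k. D + 1 / real (Suc k)) \<longlonglongrightarrow> D + 0"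
      by (intro tendsto_intros LIMSEQ_Suc[OF lim_1_over_n])
  qed (use x(2) less_imp_le in blast)
  then have min: "(norm (g - p))\<^sup>2 \<le> (norm (g - m))\<^sup>2" if "m \<in> M" for m
    using D[OF that] that by linarith
  have "inner (g - p) m = 0" if "m \<in> M" for m
  proof (cases "m = 0")
    case False
    \<comment> \<open>The \<open>t\<close> for which \<open>p + t *\<^sub>R m\<close> comes closest
      to \<open>g\<close>.\<close>
    define t where "t = inner (g - p) m / (norm m)\<^sup>2"
    have "p + t *\<^sub>R m \<in> M"
      using assms pM that by (simp add: subspace_add subspace_scale)
    from min[OF this] have "(norm (g - p))\<^sup>2 \<le> (norm ((g - p) - t *\<^sub>R m))\<^sup>2"
      by (simp add: algebra_simps)
    also have "(norm (a - t *\<^sub>R m))\<^sup>2 = (norm a)\<^sup>2 - 2 * t * inner a m + t\<^sup>2 * (norm m)\<^sup>2" for a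
      by (simp add: power2_norm_eq_inner inner_diff inner_commute)
        (simp add: power2_eq_square algebra_simps)
    also have "t\<^sup>2 * (norm m)\<^sup>2 = t * inner (g - p) m"
      using False by (simp add: t_def power2_eq_square)
    finally have "(inner (g - p) m)\<^sup>2 / (norm m)\<^sup>2 \<le> 0"
      by (simp add: t_def power2_eq_square)
    then show ?thesis
      using False by (simp add: divide_le_0_iff)
  qed simp
  moreover have "g - p \<noteq> 0"
    using pM assms(3) by auto
  ultimately show ?thesis using that by blast
qed

text \<open>Density of the span of the kernels in usable form: a vector orthogonal to the closed
  subspace where \<open>A\<close> and \<open>B\<close> agree is orthogonal to all kernels, so it
  vanishes at every point.\<close>

lemma bounded_operators_eqI:
  assumes A: "A \<in> bounded_operators" and B: "B \<in> bounded_operators"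
    and eq: "\<And>u. A (kernel u) = B (kernel u)"
  shows "A = B"
proof -
  interpret A: bounded_linear A using A by (simp add: bounded_operators_def)
  interpret B: bounded_linear B using B by (simp add: bounded_operators_def)
  have scaleC: "A (c *\<^sub>C f) = c *\<^sub>C A f" "B (c *\<^sub>C f) = c *\<^sub>C B f" for c f
    using A B by (simp_all add: bounded_operators_def linear_iff_module_hom module_hom.scale)
  let ?M = "{f. A f = B f}"
  have "g \<in> ?M" for g
  proof (rule ccontr)
    assume "g \<notin> ?M"
    moreover have "closed ?M"
      by (intro closed_Collect_eq A.continuous_on B.continuous_on continuous_on_id)
    moreover have "subspace ?M"
      by (auto simp: subspace_def A.zero B.zero A.add B.add A.scaleR B.scaleR)
    ultimately obtain f where f: "f \<noteq> 0" "\<And>m. m \<in> ?M \<Longrightarrow> inner f m = 0"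
      using closed_subspace_orthogonal by metis
    have "fock_fun f u = 0" for u
    proof (rule complex_eqI)
      show "Re (fock_fun f u) = Re 0"
        using f(2)[of "kernel u"] eq by (simp add: inner_fock_def cinner_kernel)
      \<comment> \<open>\<open>inner\<close> sees real parts only. The multiple of the kernel by
        \<open>\<i>\<close>, in \<open>?M\<close> by complex linearity, detects the imaginary
        part.\<close>
      show "Im (fock_fun f u) = Im 0"
        using f(2)[of "\<i> *\<^sub>C kernel u"] eq
        by (simp add: inner_fock_def cinner_kernel cinner_scaleC_right scaleC)
    qed
    then have "f = 0"
      by (intro fock_fun_inject[THEN iffD1]) (simp add: fun_eq_iff zero_fock.rep_eq)
    with f show False by simp
  qed
  then show ?thesis by auto
qed

section \<open>The singular integral operator on kernels\<close>

text \<open>The pointwise bound on \<open>\<phi>\<close> costs only half of the Gaussian decay, up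
  to factors exponential in \<open>norm w\<close>.\<close>

lemma integrable_sing_int_kernel:
  "integrable gauss (\<lambda>w. fock_fun (kernel u) w * exp (z * cnj w) * fock_fun \<phi> (z - cnj w))"
proof (rule Bochner_Integration.integrable_bound)
  define C where "C = norm \<phi> * exp ((norm z)\<^sup>2 / 2)"
  have "0 \<le> C" by (simp add: C_def)
  \<comment> \<open>In the linear coefficient, \<open>norm u\<close> comes from the kernel; the
    exponential factor and the cross term of \<open>(norm z + norm w)\<^sup>2 / 2\<close> give
    \<open>norm z\<close> each.\<close>
  show "integrable gauss (\<lambda>w. C * exp (1 / 2 * (norm w)\<^sup>2 + (norm u + 2 * norm z) * norm w))"
    by (intro integrable_mult_right integrable_gauss_exp_norm) simp
  have bound: "norm (fock_fun (kernel u) w * exp (z * cnj w) * fock_fun \<phi> (z - cnj w))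
      \<le> C * exp (1 / 2 * (norm w)\<^sup>2 + (norm u + 2 * norm z) * norm w)" for w
  proof -
    have "norm (fock_fun (kernel u) w * exp (z * cnj w) * fock_fun \<phi> (z - cnj w))
        \<le> exp (norm w * norm u) * exp (norm z * norm w) * (norm \<phi> * exp ((norm z + norm w)\<^sup>2 / 2))"
      unfolding norm_mult
    proof (intro mult_mono mult_nonneg_nonneg norm_ge_zero exp_ge_zero)
      show "norm (fock_fun (kernel u) w) \<le> exp (norm w * norm u)"
        using norm_exp[of "w * cnj u"] by (simp add: kernel.rep_eq norm_mult)
      show "norm (exp (z * cnj w)) \<le> exp (norm z * norm w)"
        using norm_exp[of "z * cnj w"] by (simp add: norm_mult)
      have "norm (z - cnj w) \<le> norm z + norm w"
        using norm_triangle_ineq4[of z "cnj w"] by simp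
      then have "norm \<phi> * exp ((norm (z - cnj w))\<^sup>2 / 2) \<le> norm \<phi> * exp ((norm z + norm w)\<^sup>2 / 2)"
        by (intro mult_left_mono) (simp_all add: power_mono)
      then show "norm (fock_fun \<phi> (z - cnj w)) \<le> norm \<phi> * exp ((norm z + norm w)\<^sup>2 / 2)"
        using norm_fock_fun_le order_trans by blast
    qed
    also have "\<dots> = C * exp (1 / 2 * (norm w)\<^sup>2 + (norm u + 2 * norm z) * norm w)"
      by (simp add: C_def exp_add[symmetric] power2_sum field_simps)
    finally show ?thesis .
  qed
  then show "AE w in gauss. norm (fock_fun (kernel u) w * exp (z * cnj w) * fock_fun \<phi> (z - cnj w))
      \<le> norm (C * exp (1 / 2 * (norm w)\<^sup>2 + (norm u + 2 * norm z) * norm w))"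
    using \<open>0 \<le> C\<close> by (simp add: abs_mult)
qed measurable

text \<open>All factors of the integrand except the kernel are antiholomorphic in \<open>w\<close>.
  Conjugating the whole integral makes them holomorphic, and the reproducing formula evaluates them
  at \<open>u\<close>.\<close>

lemma sing_int_kernel:
  "sing_int \<phi> (kernel u) z = exp (z * cnj u) * fock_fun \<phi> (z - cnj u)"
proof -
  let ?h = "\<lambda>w. cnj (exp (z * cnj w) * fock_fun \<phi> (z - cnj w))"
  have "(\<lambda>w. exp (z * w) * fock_fun \<phi> (z - w)) holomorphic_on UNIV"
  proof -
    have "(\<lambda>w. fock_fun \<phi> (z - w)) holomorphic_on UNIV"
      using holomorphic_on_compose_gen[of "\<lambda>w. z - w" UNIV "fock_fun \<phi>" UNIV] holomorphic_fock_fun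
      by (simp add: o_def holomorphic_intros)
    then show ?thesis
      by (intro holomorphic_intros)
  qed
  moreover have "range cnj = UNIV"
    by (metis complex_cnj_cnj surjI)
  ultimately have hol: "?h holomorphic_on UNIV"
    using holomorphic_on_compose_cnj_cnj[of "\<lambda>w. exp (z * w) * fock_fun \<phi> (z - w)" UNIV]
    by (simp add: o_def)
  have eq: "?h w * cnj (exp (w * cnj u))
      = cnj (fock_fun (kernel u) w * exp (z * cnj w) * fock_fun \<phi> (z - cnj w))" for w
    by (simp add: kernel.rep_eq)
  have "cnj (sing_int \<phi> (kernel u) z) = (\<integral>w. ?h w * cnj (exp (w * cnj u)) \<partial>gauss)"
    unfolding sing_int_def eq by (rule Bochner_Integration.integral_cnj[symmetric])
  also have "\<dots> = ?h u"
    using integrable_sing_int_kernel[of u z \<phi>]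
    by (intro gauss_reproducing[OF hol]) (simp only: eq integrable_cnj)
  finally show ?thesis
    by (metis complex_cnj_cnj)
qed

lemma bounded_operators_scaleC: "A \<in> bounded_operators \<Longrightarrow> A (c *\<^sub>C f) = c *\<^sub>C A f"
  by (simp add: bounded_operators_def linear_iff_module_hom module_hom.scale)

lemma bounded_operators_add: "A \<in> bounded_operators \<Longrightarrow> A (f + g) = A f + A g"
  by (simp add: bounded_operators_def bounded_linear.linear linear_add)

lemma bounded_operators_zero: "A \<in> bounded_operators \<Longrightarrow> A 0 = 0"
  by (simp add: bounded_operators_def bounded_linear.linear linear_0)

lemma bounded_operatorsI:
  assumes "\<And>f g. A (f + g) = A f + A g" "\<And>c f. A (c *\<^sub>C f) = c *\<^sub>C A f"
    and "\<And>f. norm (A f) \<le> norm f * K"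
  shows "A \<in> bounded_operators"
proof -
  have "A (r *\<^sub>R f) = r *\<^sub>R A f" for r f
  proof -
    have "r *\<^sub>R g = of_real r *\<^sub>C g" for g by transfer simp
    then show ?thesis by (simp add: assms)
  qed
  then have "bounded_linear A"
    using assms by (intro bounded_linear_intro[where K = K]) auto
  moreover have "Vector_Spaces.linear scaleC scaleC A"
    using assms by unfold_locales auto
  ultimately show ?thesis by (simp add: bounded_operators_def)
qed

text \<open>Removes the integral from the definition: on kernels it has a closed form, and linearity
  covers their span. Both inclusions work with this criterion.\<close>

lemma extends_sing_int_iff:
  assumes A: "A \<in> bounded_operators"
  shows "extends_sing_int \<phi> A \<longleftrightarrow>
    (\<forall>u z. fock_fun (A (kernel u)) z = exp (z * cnj u) * fock_fun \<phi> (z - cnj u))"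
proof
  assume "extends_sing_int \<phi> A"
  then have "fock_fun (A (kernel u)) = sing_int \<phi> (kernel u)" for u
    unfolding extends_sing_int_def by (simp add: cfock.span_base)
  then show "\<forall>u z. fock_fun (A (kernel u)) z = exp (z * cnj u) * fock_fun \<phi> (z - cnj u)"
    by (simp add: sing_int_kernel)
next
  assume eq: "\<forall>u z. fock_fun (A (kernel u)) z = exp (z * cnj u) * fock_fun \<phi> (z - cnj u)"
  let ?i = "\<lambda>f z w. fock_fun f w * exp (z * cnj w) * fock_fun \<phi> (z - cnj w)"
  \<comment> \<open>Integrability is carried along because the integral is additive only on
    integrable functions; a divergent one has the default value 0.\<close>
  let ?S = "{f. \<forall>z. integrable gauss (?i f z) \<and> fock_fun (A f) z = (\<integral>w. ?i f z w \<partial>gauss)}"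
  have "cfock.span (range kernel) \<subseteq> ?S"
  proof (rule cfock.span_minimal)
    show "cfock.subspace ?S"
      by (auto simp: cfock.subspace_def bounded_operators_zero[OF A] bounded_operators_add[OF A]
          bounded_operators_scaleC[OF A] zero_fock.rep_eq plus_fock.rep_eq scaleC.rep_eq
          distrib_right mult.assoc)
    show "range kernel \<subseteq> ?S"
      using eq integrable_sing_int_kernel by (auto simp: sing_int_kernel[unfolded sing_int_def])
  qed
  then show "extends_sing_int \<phi> A"
    by (auto simp: extends_sing_int_def sing_int_def fun_eq_iff)
qed

section \<open>Conjugation by Weyl operators; singular integral operators are vertical\<close>

lemma weyl_weyl_minus [simp]: "weyl z (weyl (- z) f) = f"
  using weyl_inverse[of z] by (simp add: fun_eq_iff)

lemma cinner_weyl: "cinner (weyl z f) g = cinner f (weyl (- z) g)"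
  using weyl_adjoint[of z] by (simp add: adjoint_of_def)

lemma weyl_bounded: "weyl z \<in> bounded_operators"
proof (rule bounded_operatorsI[where K = 1])
  fix f
  have "cinner (weyl z f) (weyl z f) = cinner f f"
    using weyl_weyl_minus[of "- z" f] by (simp add: cinner_weyl)
  then show "norm (weyl z f) \<le> norm f * 1"
    by (simp add: norm_eq_sqrt_inner inner_fock_def)
qed (transfer, simp add: algebra_simps)+

lemma bounded_operators_comp:
  assumes "A \<in> bounded_operators" "B \<in> bounded_operators"
  shows "A \<circ> B \<in> bounded_operators"
  using assms bounded_linear_compose[of A B] Vector_Spaces.linear_compose[of scaleC scaleC B scaleC A]
  by (simp add: bounded_operators_def o_def)

lemma alpha_bounded: "A \<in> bounded_operators \<Longrightarrow> alpha z A \<in> bounded_operators"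
  by (simp add: alpha_def bounded_operators_comp weyl_bounded)

text \<open>Weyl operators permute the kernels up to scalars. The exponent equals
  \<open>w * cnj u - (w - h) * cnj (u - h)\<close> because \<open>h\<close> is real, so normalising
  by \<open>exp (- w * cnj u)\<close> leaves a pure translation.\<close>

lemma alpha_kernel:
  assumes "A \<in> bounded_operators"
  shows "fock_fun (alpha (of_real h) A (kernel u)) w
    = exp (w * h - h\<^sup>2 + h * cnj u) * fock_fun (A (kernel (u - h))) (w - h)"
  by (simp add: alpha_def weyl_kernel bounded_operators_scaleC[OF assms]
      bounded_operators_scaleC[OF weyl_bounded] scaleC.rep_eq weyl.rep_eq nkernel_def
      mult.assoc[symmetric] exp_add[symmetric] flip: of_real_power)
    (simp add: field_simps flip: of_real_power)

text \<open>The difference \<open>z - cnj u\<close> does not change when both terms move by the same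
  real \<open>h\<close>, and agreement on kernels is enough.\<close>

lemma singular_imp_vertical:
  assumes A: "A \<in> bounded_operators" and ext: "extends_sing_int \<phi> A"
  shows "alpha (of_real h) A = A"
proof (rule bounded_operators_eqI[OF alpha_bounded[OF A] A])
  fix u
  have K: "fock_fun (A (kernel u)) z = exp (z * cnj u) * fock_fun \<phi> (z - cnj u)" for u z
    using ext A by (simp add: extends_sing_int_iff)
  have "fock_fun (alpha (of_real h) A (kernel u)) w = fock_fun (A (kernel u)) w" for w
    unfolding alpha_kernel[OF A] K mult.assoc[symmetric] exp_add[symmetric]
    by (simp add: algebra_simps power2_eq_square)
  then show "alpha (of_real h) A (kernel u) = A (kernel u)"
    by (simp add: fock_fun_inject[symmetric] fun_eq_iff)
qed

section \<open>Holomorphic dependence of \<open>A (kernel (cnj v))\<close> on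
  \<open>v\<close>\<close>

lemma power_over_fact_le_exp:
  fixes x :: real
  assumes "0 \<le> x"
  shows "x ^ n / fact n \<le> exp x"
proof -
  have "(\<Sum>k\<in>{n}. x ^ k /\<^sub>R fact k) \<le> exp x"
    unfolding exp_def using assms by (intro sum_le_suminf summable_exp_generic) auto
  then show ?thesis by (simp add: field_simps)
qed

lemma fock_space_power: "(\<lambda>w. w ^ n) \<in> fock_space"
proof -
  have "integrable gauss (\<lambda>w::complex. (norm (w ^ n))\<^sup>2)"
  proof (rule Bochner_Integration.integrable_bound)
    show "integrable gauss (\<lambda>w. fact (n * 2) * exp (0 * (norm w)\<^sup>2 + 1 * norm w))"
      by (intro integrable_mult_right integrable_gauss_exp_norm) simp
    show "AE w::complex in gauss. norm ((norm (w ^ n))\<^sup>2)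
        \<le> norm (fact (n * 2) * exp (0 * (norm w)\<^sup>2 + 1 * norm w))"
      using power_over_fact_le_exp[of "norm w" "n * 2" for w :: complex]
      by (simp add: norm_power power_mult[symmetric] field_simps)
  qed measurable
  then show ?thesis
    by (auto simp: fock_space_def intro: holomorphic_intros)
qed

lift_definition monomial :: "nat \<Rightarrow> fock" is "\<lambda>n w. w ^ n"
  by (rule fock_space_power)

lemma fock_fun_sum: "fock_fun (sum f I) z = (\<Sum>i\<in>I. fock_fun (f i) z)"
  by (induction I rule: infinite_finite_induct) (auto simp: zero_fock.rep_eq plus_fock.rep_eq)

text \<open>Replacing \<open>norm z ^ n\<close> by \<open>(1/2) ^ n * (2 * norm z) ^ n\<close>
  trades the factorial for geometric decay, at the price of a larger exponent that does not depend
  on \<open>n\<close>.\<close>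

lemma norm_exp_minus_Taylor_le:
  fixes z :: complex
  shows "norm (exp z - (\<Sum>i\<le>n. z ^ i / fact i)) \<le> (1/2) ^ n * exp (4 * norm z)"
proof -
  \<comment> \<open>The exponent 4 is 1 + 1 + 2: one from the Taylor remainder, the others from
    these two bounds.\<close>
  have "norm z \<le> exp (norm z)" "(2 * norm z) ^ n / fact n \<le> exp (2 * norm z)"
    using power_over_fact_le_exp[of "norm z" 1] power_over_fact_le_exp[of "2 * norm z" n] by simp_all
  then have "exp (norm z) * (norm z * ((2 * norm z) ^ n / fact n))
      \<le> exp (norm z) * (exp (norm z) * exp (2 * norm z))"
    by (intro mult_left_mono mult_mono) auto
  also have "\<dots> = exp (4 * norm z)"
    by (simp add: exp_add[symmetric])
  finally have "(1/2) ^ n * (exp (norm z) * (norm z * ((2 * norm z) ^ n / fact n)))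
      \<le> (1/2) ^ n * exp (4 * norm z)"
    by (intro mult_left_mono) auto
  moreover have "(1/2) ^ n * (exp (norm z) * (norm z * ((2 * norm z) ^ n / fact n)))
      = exp (norm z) * (norm z ^ Suc n) / fact n"
    by (simp add: power_mult_distrib power_divide)
  ultimately show ?thesis
    using Taylor_exp_field[of z n] by linarith
qed

text \<open>The pointwise remainder bound is square integrable, so the monomial expansion of the
  kernels converges in norm, uniformly for \<open>v\<close> in a disc.\<close>

lemma kernel_Taylor_bound:
  obtains C where "\<And>v n. norm v \<le> R \<Longrightarrow>
    norm (kernel (cnj v) - (\<Sum>i\<le>n. (v ^ i / fact i) *\<^sub>C monomial i)) \<le> (1/2) ^ n * C"
proof
  fix v :: complex and n assume v: "norm v \<le> R"
  \<comment> \<open>The exponent \<open>4 * norm (w * v)\<close> is at most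
    \<open>4 * R * norm w\<close>, and squaring doubles it. Neither \<open>v\<close> nor
    \<open>n\<close> enters, so the integral of \<open>?g\<close> yields the constant.\<close>
  let ?g = "\<lambda>w::complex. exp (0 * (norm w)\<^sup>2 + (8 * R) * norm w)"
  let ?D = "kernel (cnj v) - (\<Sum>i\<le>n. (v ^ i / fact i) *\<^sub>C monomial i)"
  have D: "(norm (fock_fun ?D w))\<^sup>2 \<le> ((1/2) ^ n)\<^sup>2 * ?g w" for w
  proof -
    have "norm (fock_fun ?D w) = norm (exp (w * v) - (\<Sum>i\<le>n. (w * v) ^ i / fact i))"
      by (simp add: minus_fock.rep_eq fock_fun_sum scaleC.rep_eq monomial.rep_eq kernel.rep_eq
          power_mult_distrib mult.commute)
    also have "\<dots> \<le> (1/2) ^ n * exp (4 * norm (w * v))"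
      by (rule norm_exp_minus_Taylor_le)
    also have "\<dots> \<le> (1/2) ^ n * exp (4 * R * norm w)"
      using v by (intro mult_left_mono) (auto simp: norm_mult mult.commute mult_right_mono)
    finally have "(norm (fock_fun ?D w))\<^sup>2 \<le> ((1/2) ^ n * exp (4 * R * norm w))\<^sup>2"
      by (intro power_mono) auto
    then show ?thesis
      by (simp add: power_mult_distrib exp_double[symmetric] mult.assoc)
  qed
  have int: "integrable gauss ?g"
    by (rule integrable_gauss_exp_norm) simp
  have "(norm ?D)\<^sup>2 = (\<integral>w. (norm (fock_fun ?D w))\<^sup>2 \<partial>gauss)"
    by (simp add: norm_fock)
  also have "\<dots> \<le> (\<integral>w. ((1/2) ^ n)\<^sup>2 * ?g w \<partial>gauss)"
    using D int fock_fun[of ?D] by (intro integral_mono) (auto simp: fock_space_def)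
  also have "\<dots> = ((1/2) ^ n * sqrt (\<integral>w. ?g w \<partial>gauss))\<^sup>2"
    by (simp add: power_mult_distrib)
  finally show "norm ?D \<le> (1/2) ^ n * sqrt (\<integral>w. ?g w \<partial>gauss)"
    by (rule power2_le_imp_le) simp
qed

lemma bounded_operators_sum:
  assumes "A \<in> bounded_operators"
  shows "A (\<Sum>i\<in>I. c i *\<^sub>C f i) = (\<Sum>i\<in>I. c i *\<^sub>C A (f i))"
  by (induction I rule: infinite_finite_induct)
    (auto simp: bounded_operators_zero bounded_operators_add bounded_operators_scaleC assms)

text \<open>Applying \<open>A\<close> to the Taylor polynomials and evaluating gives entire
  functions of \<open>h\<close>; boundedness of \<open>A\<close> and of evaluation makes their
  convergence locally uniform. Both \<open>p\<close> and \<open>q\<close> vary because the identity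
  theorem is used along a simultaneous shift.\<close>

lemma holomorphic_operator_kernel:
  assumes A: "A \<in> bounded_operators"
    and p: "p holomorphic_on UNIV" and q: "q holomorphic_on UNIV"
  shows "(\<lambda>h. fock_fun (A (kernel (cnj (p h)))) (q h)) holomorphic_on UNIV"
proof (rule holomorphic_uniform_sequence)
  let ?P = "\<lambda>n v. \<Sum>i\<le>n. (v ^ i / fact i) *\<^sub>C monomial i"
  let ?f = "\<lambda>n h. \<Sum>i\<le>n. (p h ^ i / fact i) * fock_fun (A (monomial i)) (q h)"
  show "?f n holomorphic_on UNIV" for n
  proof (intro holomorphic_intros p)
    show "(\<lambda>h. fock_fun (A (monomial i)) (q h)) holomorphic_on UNIV" for i
      using holomorphic_on_compose_gen[of q UNIV "fock_fun (A (monomial i))" UNIV] q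
      by (simp add: o_def holomorphic_fock_fun)
  qed auto
  fix x :: complex
  have "bounded (p ` cball x 1)" "bounded (q ` cball x 1)"
    using p q by (auto intro!: compact_imp_bounded compact_continuous_image
        holomorphic_on_imp_continuous_on intro: holomorphic_on_subset)
  then obtain R S where "\<forall>y\<in>p ` cball x 1. norm y \<le> R" "\<forall>y\<in>q ` cball x 1. norm y \<le> S"
    unfolding bounded_iff by blast
  then have R: "\<And>h. h \<in> cball x 1 \<Longrightarrow> norm (p h) \<le> R"
    and S: "\<And>h. h \<in> cball x 1 \<Longrightarrow> norm (q h) \<le> S"
    by blast+
  obtain C where C: "\<And>v n. norm v \<le> R \<Longrightarrow> norm (kernel (cnj v) - ?P n v) \<le> (1/2) ^ n * C"
    using kernel_Taylor_bound[of R] by blast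
  interpret bounded_linear A using A by (simp add: bounded_operators_def)
  obtain K where K: "K \<ge> 0" "\<And>f. norm (A f) \<le> norm f * K"
    using nonneg_bounded by blast
  define B where "B = C * K * exp (S\<^sup>2 / 2)"
  have le: "dist (?f n h) (fock_fun (A (kernel (cnj (p h)))) (q h)) \<le> (1/2) ^ n * B"
    if h: "h \<in> cball x 1" for n h
  proof -
    let ?D = "kernel (cnj (p h)) - ?P n (p h)"
    have "?f n h = fock_fun (A (?P n (p h))) (q h)"
      by (simp add: bounded_operators_sum[OF A] fock_fun_sum scaleC.rep_eq)
    then have "dist (?f n h) (fock_fun (A (kernel (cnj (p h)))) (q h)) = norm (fock_fun (A ?D) (q h))"
      by (simp add: diff minus_fock.rep_eq dist_norm norm_minus_commute)
    also have "\<dots> \<le> norm (A ?D) * exp ((norm (q h))\<^sup>2 / 2)"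
      by (rule norm_fock_fun_le)
    also have "\<dots> \<le> ((1/2) ^ n * C * K) * exp (S\<^sup>2 / 2)"
    proof (intro mult_mono)
      have "norm (A ?D) \<le> norm ?D * K" by (rule K)
      also have "\<dots> \<le> (1/2) ^ n * C * K"
        using C[OF R[OF h]] K(1) by (intro mult_right_mono)
      finally show *: "norm (A ?D) \<le> (1/2) ^ n * C * K" .
      \<comment> \<open>The sign of \<open>C\<close> is not given; the product is nonnegative
        because it bounds a norm.\<close>
      show "0 \<le> (1/2) ^ n * C * K"
        using * norm_ge_zero order_trans by blast
    qed (use S[OF h] in \<open>auto intro!: power_mono\<close>)
    finally show ?thesis by (simp add: B_def mult.assoc)
  qed
  have "uniform_limit (cball x 1) ?f (\<lambda>h. fock_fun (A (kernel (cnj (p h)))) (q h)) sequentially"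
  proof (rule uniform_limitI)
    fix e :: real assume e: "0 < e"
    have "(\<lambda>n. (1/2) ^ n * B) \<longlonglongrightarrow> 0 * B"
      by (intro tendsto_intros LIMSEQ_realpow_zero) auto
    then have "\<forall>\<^sub>F n in sequentially. (1/2) ^ n * B < e"
      using e by (intro order_tendstoD(2)[where y = "0 * B"]) auto
    then show "\<forall>\<^sub>F n in sequentially. \<forall>h\<in>cball x 1.
        dist (?f n h) (fock_fun (A (kernel (cnj (p h)))) (q h)) < e"
      by (rule eventually_mono) (blast intro: le_less_trans le)
  qed
  then show "\<exists>d>0. cball x d \<subseteq> UNIV
      \<and> uniform_limit (cball x d) ?f (\<lambda>h. fock_fun (A (kernel (cnj (p h)))) (q h)) sequentially"
    by (intro exI[of _ 1]) auto
qed auto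

section \<open>Vertical operators are singular integral operators\<close>

text \<open>\<open>kernel 0\<close> is the constant function 1, so the symbol is the restriction of
  \<open>F\<close> to \<open>v = 0\<close>.\<close>

lemma vertical_imp_singular:
  assumes A: "A \<in> vertical_operators"
  shows "extends_sing_int (A (kernel 0)) A"
proof -
  have bd: "A \<in> bounded_operators" and vert: "alpha (of_real h) A = A" for h
    using A by (auto simp: vertical_operators_def)
  define F where "F z v = exp (- (z * v)) * fock_fun (A (kernel (cnj v))) z" for z v
  have real: "F (z + of_real h) (v + of_real h) = F z v" for h z v
  proof -
    have "fock_fun (A (kernel (cnj v + h))) (z + h)
        = exp ((z + h) * h - h\<^sup>2 + h * (v + h)) * fock_fun (A (kernel (cnj v))) z"
      using alpha_kernel[OF bd, of h "cnj v + h" "z + h"] by (simp add: vert)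
    then show ?thesis
      by (simp add: F_def mult.assoc[symmetric] exp_add[symmetric])
        (simp add: algebra_simps power2_eq_square)
  qed
  have const: "F (z + h) (v + h) - F z v = 0" for h z v
  proof (rule analytic_continuation[where f = "\<lambda>h. F (z + h) (v + h) - F z v"
        and S = UNIV and U = "\<real>" and \<xi> = 0])
    show "(\<lambda>h. F (z + h) (v + h) - F z v) holomorphic_on UNIV"
      unfolding F_def by (intro holomorphic_intros holomorphic_operator_kernel bd)
    \<comment> \<open>The identity theorem needs a limit point of the zeros; all reals are zeros by
      \<open>real\<close>.\<close>
    show "0 islimpt (\<real> :: complex set)"
      unfolding islimpt_approachable
    proof (intro allI impI)
      fix e :: real assume "0 < e"
      then show "\<exists>x'\<in>\<real>. x' \<noteq> 0 \<and> dist x' (0 :: complex) < e"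
        by (intro bexI[of _ "of_real (e / 2)"]) auto
    qed
  qed (use real in \<open>auto elim!: Reals_cases\<close>)
  show ?thesis
    unfolding extends_sing_int_iff[OF bd]
  proof (intro allI)
    fix u z
    have "F z (cnj u) = fock_fun (A (kernel 0)) (z - cnj u)"
      using const[of z "- cnj u" "cnj u"] by (simp add: F_def)
    then show "fock_fun (A (kernel u)) z = exp (z * cnj u) * fock_fun (A (kernel 0)) (z - cnj u)"
      by (simp add: F_def exp_minus field_simps)
  qed
qed

section \<open>The von Neumann algebra of vertical operators\<close>

text \<open>A matrix coefficient of \<open>alpha h A\<close> is one of \<open>A\<close> at
  translated vectors, so a single vertical \<open>B\<close> can approximate both it and the original
  coefficient.\<close>

lemma vertical_operators_wot_closed: "wot_closed vertical_operators"
  unfolding wot_closed_def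
proof (intro ballI impI)
  fix A assume A: "A \<in> bounded_operators"
    and approx: "\<forall>P e. finite P \<and> e > 0 \<longrightarrow>
      (\<exists>B\<in>vertical_operators. \<forall>(f, g)\<in>P. norm (cinner (A f - B f) g) < e)"
  have "alpha (of_real h) A = A" for h
  proof (rule bounded_operators_eqI[OF alpha_bounded[OF A] A])
    fix u
    let ?f = "kernel u" and ?W = "weyl (- of_real h)"
    have "cinner (alpha (of_real h) A ?f - A ?f) g = 0" for g
    proof (rule ccontr)
      let ?x = "cinner (alpha (of_real h) A ?f - A ?f) g"
      assume "?x \<noteq> 0"
      then obtain B where B: "B \<in> vertical_operators"
        and less: "norm (cinner (A ?f - B ?f) g) < norm ?x / 2"
          "norm (cinner (A (?W ?f) - B (?W ?f)) (?W g)) < norm ?x / 2"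
        using approx[rule_format, of "{(?f, g), (?W ?f, ?W g)}" "norm ?x / 2"] by auto
      have "weyl h (B (?W ?f)) = B ?f"
        using B by (simp add: vertical_operators_def alpha_def fun_eq_iff)
      then have "cinner (B (?W ?f)) (?W g) = cinner (B ?f) g"
        by (simp flip: cinner_weyl)
      \<comment> \<open>The two coefficients of \<open>B\<close> coincide and cancel, leaving two
        errors, each below half of \<open>norm ?x\<close>.\<close>
      then have "?x = cinner (A (?W ?f) - B (?W ?f)) (?W g) - cinner (A ?f - B ?f) g"
        by (simp add: cinner_diff_left alpha_def cinner_weyl)
      then have "norm ?x \<le> norm (cinner (A (?W ?f) - B (?W ?f)) (?W g)) + norm (cinner (A ?f - B ?f) g)"
        using norm_triangle_ineq4 by metis
      with less show False by linarith
    qed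
    then have "inner (alpha (of_real h) A ?f - A ?f) (alpha (of_real h) A ?f - A ?f) = 0"
      by (simp add: inner_fock_def)
    then show "alpha (of_real h) A ?f = A ?f" by simp
  qed
  with A show "A \<in> vertical_operators" by (simp add: vertical_operators_def)
qed

lemma bounded_operators_id: "id \<in> bounded_operators"
  by (rule bounded_operatorsI[where K = 1]) auto

lemma vertical_operators_bounded: "A \<in> vertical_operators \<Longrightarrow> A \<in> bounded_operators"
  by (simp add: vertical_operators_def)

text \<open>Invariance under \<open>alpha\<close> becomes commutation with the real Weyl operators,
  a condition that passes readily to sums, products and adjoints.\<close>

lemma vertical_operatorsI:
  assumes "A \<in> bounded_operators"
    and "\<And>h f. weyl (of_real h) (A f) = A (weyl (of_real h) f)"
  shows "A \<in> vertical_operators"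
  using assms by (simp add: vertical_operators_def alpha_def fun_eq_iff)

lemma vertical_operatorsD:
  assumes "A \<in> vertical_operators"
  shows "weyl (of_real h) (A f) = A (weyl (of_real h) f)"
proof -
  have "weyl h (A (weyl (- h) (weyl h f))) = A (weyl h f)"
    using assms by (simp add: vertical_operators_def alpha_def fun_eq_iff)
  then show ?thesis
    using weyl_weyl_minus[of "- of_real h" f] by simp
qed

lemma von_neumann_algebra_vertical_operators: "von_neumann_algebra vertical_operators"
  unfolding von_neumann_algebra_def
proof (intro conjI ballI allI impI)
  show "vertical_operators \<subseteq> bounded_operators"
    by (auto simp: vertical_operators_def)
  show "id \<in> vertical_operators"
    by (rule vertical_operatorsI) (auto simp: bounded_operators_id)
  show "wot_closed vertical_operators"
    by (rule vertical_operators_wot_closed)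
  note weyl_linear = bounded_operators_add[OF weyl_bounded] bounded_operators_scaleC[OF weyl_bounded]
  fix A assume A: "A \<in> vertical_operators"
  note A_linear = bounded_operators_add[OF vertical_operators_bounded[OF A]]
    bounded_operators_scaleC[OF vertical_operators_bounded[OF A]]
  obtain K where K: "\<And>f. norm (A f) \<le> norm f * K"
    using vertical_operators_bounded[OF A] bounded_linear.bounded by (auto simp: bounded_operators_def)
  show "(\<lambda>f. c *\<^sub>C A f) \<in> vertical_operators" for c
  proof (rule vertical_operatorsI)
    show "(\<lambda>f. c *\<^sub>C A f) \<in> bounded_operators"
    proof (rule bounded_operatorsI[where K = "norm c * K"])
      show "norm (c *\<^sub>C A f) \<le> norm f * (norm c * K)" for f
        using mult_left_mono[OF K[of f], of "norm c"] by (simp add: norm_scaleC mult_ac)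
    qed (simp_all add: A_linear cfock.scale_right_distrib mult.commute)
  qed (simp add: weyl_linear vertical_operatorsD[OF A])
  {
    fix B assume B: "B \<in> vertical_operators"
    note B_linear = bounded_operators_add[OF vertical_operators_bounded[OF B]]
      bounded_operators_scaleC[OF vertical_operators_bounded[OF B]]
    obtain L where L: "\<And>f. norm (B f) \<le> norm f * L"
      using vertical_operators_bounded[OF B] bounded_linear.bounded by (auto simp: bounded_operators_def)
    show "(\<lambda>f. A f + B f) \<in> vertical_operators"
    proof (rule vertical_operatorsI)
      show "(\<lambda>f. A f + B f) \<in> bounded_operators"
      proof (rule bounded_operatorsI[where K = "K + L"])
        show "norm (A f + B f) \<le> norm f * (K + L)" for f
          using norm_triangle_ineq[of "A f" "B f"] K[of f] L[of f] by (simp add: distrib_left)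
      qed (simp_all add: A_linear B_linear cfock.scale_right_distrib add_ac)
    qed (simp add: weyl_linear vertical_operatorsD[OF A] vertical_operatorsD[OF B])
    show "A \<circ> B \<in> vertical_operators"
      by (rule vertical_operatorsI)
        (simp_all add: bounded_operators_comp vertical_operators_bounded A B vertical_operatorsD)
  }
  fix B assume B: "B \<in> bounded_operators" and adj: "adjoint_of B A"
  show "B \<in> vertical_operators"
  proof (rule vertical_operatorsI[OF B])
    fix h f
    \<comment> \<open>The adjoint of \<open>weyl h\<close> is \<open>weyl (- h)\<close>, again a
      real translation, so commutation passes from \<open>A\<close> to its adjoint.\<close>
    have "cinner g (weyl (of_real h) (B f)) = cinner g (B (weyl (of_real h) f))" for g
    proof -
      have "cinner g (weyl (of_real h) (B f)) = cinner (A (weyl (of_real (- h)) g)) f"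
        using adj cinner_weyl[of "- of_real h" g "B f"] by (simp add: adjoint_of_def)
      also have "\<dots> = cinner (weyl (of_real (- h)) (A g)) f"
        by (simp only: vertical_operatorsD[OF A])
      also have "\<dots> = cinner g (B (weyl (of_real h) f))"
        using adj by (simp add: adjoint_of_def cinner_weyl)
      finally show ?thesis .
    qed
    then have "inner g (weyl (of_real h) (B f) - B (weyl (of_real h) f)) = 0" for g
      unfolding inner_diff_right by (simp add: inner_fock_def)
    then show "weyl (of_real h) (B f) = B (weyl (of_real h) f)"
      by (metis inner_eq_zero_iff right_minus_eq)
  qed
qed

theorem theorem3p18:
  shows "bounded_singular_integral_operators = vertical_operators
    \<and> von_neumann_algebra vertical_operators"
proof
  show "bounded_singular_integral_operators = vertical_operators"
  proof (intro equalityI subsetI)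
    fix A assume "A \<in> bounded_singular_integral_operators"
    then show "A \<in> vertical_operators"
      by (auto simp: bounded_singular_integral_operators_def vertical_operators_def
          singular_imp_vertical)
  next
    fix A assume A: "A \<in> vertical_operators"
    then show "A \<in> bounded_singular_integral_operators"
      using vertical_imp_singular[OF A]
      by (auto simp: bounded_singular_integral_operators_def vertical_operators_def)
  qed
qed (rule von_neumann_algebra_vertical_operators)

end
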